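(* Let $T>0$, $0<\beta<1/2$ and $1\le q<\frac{1}{1-2\beta}$. There exists a constant $C$ such that for every $\psi\in C^\beta([0,T])$ with $\psi(0)=0$, the solution $$u(t,x)=-2\int_0^t\partial_xG(t-\tau,x)\psi(\tau)\,d\tau,\qquad (t,x)\in[0,T]\times\mathbb{R}_+,$$ of the heat equation $\partial_tu=\partial_x^2u$ on $\mathbb{R}_+$ with $u(0,x)=0$ and $u(t,0)=\psi(t)$ satisfies $$\|u\|_{L^\infty([0,T],W^{1,q}(\mathbb{R}_+))}=\sup_{t\in[0,T]}\|u(t,\cdot)\|_{W^{1,q}(\mathbb{R}_+)}\le C\|\psi\|_{C^\beta([0,T])}.$$ The constant $C$ does not depend on $\psi$.
   Context: $\mathbb{R}_+=(0,\infty)$ and $G(t,x)=\frac{1}{\sqrt{4\pi t}}e^{-x^2/(4t)}$ is the heat kernel. *)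

theory Defs
  imports "HOL-Analysis.Analysis"
begin

definition heat_kernel :: "real \<Rightarrow> real \<Rightarrow> real" where
  "heat_kernel t x = 1 / sqrt (4 * pi * t) * exp (- x\<^sup>2 / (4 * t))"

(* The integrand at the end point \<tau> = t, where the kernel is singular, is a junk value on a null set. *)
definition heat_boundary_potential :: "(real \<Rightarrow> real) \<Rightarrow> real \<Rightarrow> real \<Rightarrow> real" where
  "heat_boundary_potential \<psi> t x =
     -2 * (LBINT \<tau>:{0..t}. deriv (heat_kernel (t - \<tau>)) x * \<psi> \<tau>)"

(* Classical solutions: the equation holds pointwise for 0 < t \<le> T and x > 0 (with a one-sided
   time derivative at t = T), and u, extended by \<psi> to the boundary x = 0, is jointly
   continuous up to t = 0 and x = 0. The value of u itself at x = 0 is irrelevant. *)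
definition solves_half_line_heat_problem ::
    "real \<Rightarrow> (real \<Rightarrow> real) \<Rightarrow> (real \<Rightarrow> real \<Rightarrow> real) \<Rightarrow> bool" where
  "solves_half_line_heat_problem T \<psi> u \<longleftrightarrow>
     (\<forall>t\<in>{0<..T}. \<forall>x>0. u t differentiable at x \<and>
        (\<exists>D. ((\<lambda>s. u s x) has_real_derivative D) (at t within {0..T}) \<and>
             (deriv (u t) has_real_derivative D) (at x))) \<and>
     (\<forall>x>0. u 0 x = 0) \<and>
     continuous_on ({0..T} \<times> {0..}) (\<lambda>(t, x). if x = 0 then \<psi> t else u t x)"

definition holder_quotients :: "real \<Rightarrow> real set \<Rightarrow> (real \<Rightarrow> real) \<Rightarrow> real set" where
  "holder_quotients \<beta> S f =
     {\<bar>f s - f t\<bar> / \<bar>s - t\<bar> powr \<beta> | s t. s \<in> S \<and> t \<in> S \<and> s \<noteq> t}"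

definition holder_space :: "real \<Rightarrow> real set \<Rightarrow> (real \<Rightarrow> real) set" where
  "holder_space \<beta> S = {f. bdd_above ((\<lambda>t. \<bar>f t\<bar>) ` S) \<and> bdd_above (holder_quotients \<beta> S f)}"

definition holder_norm :: "real \<Rightarrow> real set \<Rightarrow> (real \<Rightarrow> real) \<Rightarrow> real" where
  "holder_norm \<beta> S f = (SUP t\<in>S. \<bar>f t\<bar>) + Sup (holder_quotients \<beta> S f)"

definition Lp_space :: "real \<Rightarrow> real set \<Rightarrow> (real \<Rightarrow> real) set" where
  "Lp_space q S = {f. set_borel_measurable lebesgue S f \<and>
                      set_integrable lebesgue S (\<lambda>x. \<bar>f x\<bar> powr q)}"

definition Lp_norm :: "real \<Rightarrow> real set \<Rightarrow> (real \<Rightarrow> real) \<Rightarrow> real" where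
  "Lp_norm q S f = (LINT x:S|lebesgue. \<bar>f x\<bar> powr q) powr (1 / q)"

definition test_functions :: "real set \<Rightarrow> (real \<Rightarrow> real) set" where
  "test_functions S =
     {\<phi>. (\<forall>n x. (deriv ^^ n) \<phi> differentiable at x) \<and>
         (\<exists>K. compact K \<and> K \<subseteq> S \<and> (\<forall>x. x \<notin> K \<longrightarrow> \<phi> x = 0))}"

definition locally_integrable_on :: "(real \<Rightarrow> real) \<Rightarrow> real set \<Rightarrow> bool" where
  "locally_integrable_on f S \<longleftrightarrow>
     (\<forall>K. compact K \<and> K \<subseteq> S \<longrightarrow> set_integrable lebesgue K f)"

definition has_weak_deriv :: "real set \<Rightarrow> (real \<Rightarrow> real) \<Rightarrow> (real \<Rightarrow> real) \<Rightarrow> bool" where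
  "has_weak_deriv S f g \<longleftrightarrow>
     locally_integrable_on f S \<and> locally_integrable_on g S \<and>
     (\<forall>\<phi>\<in>test_functions S.
        (LINT x:S|lebesgue. f x * deriv \<phi> x) = - (LINT x:S|lebesgue. g x * \<phi> x))"

(* For open S a weak derivative is unique up to null sets, so the chosen representative
   affects neither membership in L^q nor the L^q norm. *)
definition weak_deriv :: "real set \<Rightarrow> (real \<Rightarrow> real) \<Rightarrow> real \<Rightarrow> real" where
  "weak_deriv S f = (SOME g. has_weak_deriv S f g)"

definition W1_space :: "real \<Rightarrow> real set \<Rightarrow> (real \<Rightarrow> real) set" where
  "W1_space q S = {f \<in> Lp_space q S. \<exists>g\<in>Lp_space q S. has_weak_deriv S f g}"

definition W1_norm :: "real \<Rightarrow> real set \<Rightarrow> (real \<Rightarrow> real) \<Rightarrow> real" where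
  "W1_norm q S f = ((Lp_norm q S f) powr q + (Lp_norm q S (weak_deriv S f)) powr q) powr (1 / q)"

end

theory Submission
  imports Defs
begin

text \<open>
  The kernel \<open>- 2 * \<partial>\<^sub>x G\<close> and all its derivatives are combinations of the profiles
  \<open>s powr - b * exp (- a / s)\<close> with \<open>a = x\<^sup>2 / 4\<close>. Extended by zero to \<open>s \<le> 0\<close>, these are smooth in
  \<open>s\<close> for \<open>a > 0\<close>, so one may differentiate under the integral over the fixed interval \<open>{0..T}\<close>.

  For the bounds, extend \<open>\<psi>\<close> by zero to negative times (this keeps the Hoelder estimate, as
  \<open>\<psi> 0 = 0\<close>) and substitute \<open>\<tau> = t - x\<^sup>2 / 4 * z\<close>; the moments of the profiles become values of
  the Gamma function. The kernel of \<open>u\<close> has mass \<open>1\<close> and that of \<open>u\<^sub>x\<close> has mass \<open>0\<close>, hence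
  \<open>\<psi>\<close> may be replaced by \<open>\<psi> - \<psi> t\<close>, which gives \<open>u - \<psi> t = O(x powr (2 * \<beta>))\<close> and
  \<open>u\<^sub>x = O(x powr (2 * \<beta> - 1))\<close>. The latter is in \<open>L\<^sup>q\<close> near the boundary because
  \<open>(1 - 2 * \<beta>) * q < 1\<close>; for \<open>x \<ge> 1\<close> both decay like \<open>x powr - 2\<close>.
\<close>

section \<open>Profiles of the heat kernel\<close>

text \<open>The cutoff encodes causality: data at times after \<open>t\<close> carry no weight in a
  profile evaluated at \<open>t - \<tau>\<close>. Without it \<open>exp (- a / s)\<close> would blow
  up for negative \<open>s\<close>.\<close>

definition heat_profile :: "real \<Rightarrow> real \<Rightarrow> real \<Rightarrow> real" where
  "heat_profile b a s = (if s > 0 then s powr (- b) * exp (- a / s) else 0)"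

lemma heat_profile_nonneg [simp]: "0 \<le> heat_profile b a s"
  by (simp add: heat_profile_def)

lemma heat_profile_nonpos [simp]: "s \<le> 0 \<Longrightarrow> heat_profile b a s = 0"
  by (simp add: heat_profile_def)

lemma heat_profile_shift: "s powr c * heat_profile b a s = heat_profile (b - c) a s"
  by (simp add: heat_profile_def mult.assoc [symmetric] powr_add [symmetric])

lemma heat_profile_Suc: "s * heat_profile (b + 1) a s = heat_profile b a s"
  using heat_profile_shift [of s 1 "b + 1" a] by (cases "s > 0") (auto simp: heat_profile_def)

lemma heat_profile_scale:
  assumes "a > 0"
  shows "heat_profile b a s = a powr (- b) * heat_profile b 1 (s / a)"
  using assms by (auto simp: heat_profile_def powr_divide zero_less_divide_iff)

text \<open>With \<open>y = 1 / (s * b)\<close>, raising \<open>y \<le> exp y\<close> to the power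
  \<open>b\<close> bounds \<open>s powr - b\<close> by
  \<open>b powr b * exp (1 / s)\<close>.\<close>

lemma heat_profile_le:
  assumes "b > 0"
  shows "heat_profile b 1 s \<le> b powr b"
proof (cases "s > 0")
  case True
  have "1 / (s * b) \<le> exp (1 / (s * b))"
    using exp_ge_add_one_self [of "1 / (s * b)"] by linarith
  then have "(1 / (s * b)) powr b \<le> exp (1 / (s * b)) powr b"
    using True assms by (intro powr_mono2) auto
  also have "\<dots> = exp (1 / s)"
    using True assms by (simp add: exp_powr_real)
  finally have "s powr (- b) * exp (- 1 / s) \<le> b powr b * (exp (1 / s) * exp (- 1 / s))"
    using True assms by (simp add: powr_divide powr_mult powr_minus field_simps)
  then show ?thesis
    using True by (simp add: heat_profile_def flip: exp_add)
qed (use assms in simp)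

text \<open>Splitting off one factor \<open>s\<close> leaves the profile of exponent
  \<open>b + 1\<close>, which is bounded.\<close>

lemma heat_profile_tendsto_0:
  assumes "b \<ge> 0"
  shows "(heat_profile b 1 \<longlongrightarrow> 0) (at 0)"
proof (rule Lim_null_comparison)
  show "((\<lambda>s. \<bar>s\<bar> * (b + 1) powr (b + 1)) \<longlongrightarrow> 0) (at 0)"
    by (auto intro!: tendsto_eq_intros)
  show "\<forall>\<^sub>F s in at 0. norm (heat_profile b 1 s) \<le> \<bar>s\<bar> * (b + 1) powr (b + 1)"
    unfolding heat_profile_Suc [symmetric, of b]
    using heat_profile_le [of "b + 1"] assms
    by (intro always_eventually allI) (auto simp: abs_mult intro!: mult_left_mono)
qed

lemma DERIV_heat_profile_1:
  assumes "b \<ge> 0"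
  shows "(heat_profile b 1 has_real_derivative
           - b * heat_profile (b + 1) 1 s + heat_profile (b + 2) 1 s) (at s)"
proof -
  consider "s < 0" | "s = 0" | "s > 0" by linarith
  then show ?thesis
  proof cases
    case 1
    have "((\<lambda>s. 0) has_real_derivative 0) (at s)" by simp
    then have "(heat_profile b 1 has_real_derivative 0) (at s)"
      by (rule has_field_derivative_transform_within_open [where S = "{..<0}"]) (use 1 in auto)
    then show ?thesis using 1 by simp
  next
    case 2
    \<comment> \<open>The difference quotient at 0 is the profile of exponent \<open>b + 1\<close>,
      which tends to 0; all profiles are therefore flat there.\<close>
    have "((\<lambda>h. (heat_profile b 1 (0 + h) - heat_profile b 1 0) / h) \<longlongrightarrow> 0) (at 0)"
      by (rule Lim_transform_eventually [OF heat_profile_tendsto_0 [of "b + 1"]])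
        (use assms in \<open>auto simp: eventually_at_filter heat_profile_Suc [symmetric, of b]\<close>)
    then show ?thesis using 2 by (simp add: DERIV_def)
  next
    case 3
    have "((\<lambda>s. s powr (- b) * exp (- 1 / s)) has_real_derivative
        - b * (s powr (- (b + 1)) * exp (- 1 / s)) + s powr (- (b + 2)) * exp (- 1 / s)) (at s)"
      using 3 by (auto intro!: derivative_eq_intros
          simp: powr_diff powr_minus powr_add field_simps power2_eq_square powr_numeral)
    then have "(heat_profile b 1 has_real_derivative
        - b * (s powr (- (b + 1)) * exp (- 1 / s)) + s powr (- (b + 2)) * exp (- 1 / s)) (at s)"
      by (rule has_field_derivative_transform_within_open [where S = "{0<..}"])
        (use 3 in \<open>auto simp: heat_profile_def\<close>)
    then show ?thesis using 3 by (simp add: heat_profile_def)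
  qed
qed

text \<open>Scaling reduces this to \<open>a = 1\<close>; the powers of \<open>a\<close> are
  absorbed by the raised exponents.\<close>

lemma DERIV_heat_profile_time:
  assumes "b \<ge> 0" "a > 0"
  shows "(heat_profile b a has_real_derivative
           - b * heat_profile (b + 1) a s + a * heat_profile (b + 2) a s) (at s)"
proof -
  have "((\<lambda>s. a powr (- b) * heat_profile b 1 (s / a)) has_real_derivative
      a powr (- b) * ((- b * heat_profile (b + 1) 1 (s / a) + heat_profile (b + 2) 1 (s / a)) * (1 / a)))
      (at s)"
    using assms by (intro DERIV_cmult DERIV_chain2 [OF DERIV_heat_profile_1])
      (auto intro!: derivative_eq_intros)
  moreover have "a powr (- b) = a powr (- (b + 1)) * a" "a powr (- b) = a * a powr (- (b + 2)) * a"
    using assms by (simp_all add: powr_diff powr_minus powr_add field_simps powr_numeral power2_eq_square)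
  then have "a powr (- b) * ((- b * heat_profile (b + 1) 1 (s / a) + heat_profile (b + 2) 1 (s / a)) * (1 / a))
     = - b * heat_profile (b + 1) a s + a * heat_profile (b + 2) a s"
    using assms(2) by (simp add: heat_profile_scale [of a] field_simps)
  ultimately show ?thesis
    using assms by (simp flip: heat_profile_scale)
qed

lemma DERIV_heat_profile_space:
  "((\<lambda>a. heat_profile b a s) has_real_derivative - heat_profile (b + 1) a s) (at a)"
proof (cases "s > 0")
  case True
  have "((\<lambda>a. s powr (- b) * exp (- a / s)) has_real_derivative
          - (s powr (- (b + 1)) * exp (- a / s))) (at a)"
    using True by (auto intro!: derivative_eq_intros simp: powr_diff powr_minus powr_add field_simps)
  then show ?thesis using True by (simp add: heat_profile_def)
qed simp

lemma continuous_on_heat_profile_1: "b \<ge> 0 \<Longrightarrow> continuous_on A (heat_profile b 1)"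
  by (meson DERIV_heat_profile_1 DERIV_isCont continuous_at_imp_continuous_on)

text \<open>Joint continuity in parameter and time reduces by scaling to a function of the single
  variable \<open>g x / f x\<close>, hence the positivity of \<open>f\<close>.\<close>

lemma continuous_on_heat_profile [continuous_intros]:
  assumes "continuous_on A f" "continuous_on A g" "\<And>x. x \<in> A \<Longrightarrow> f x > 0" "b \<ge> 0"
  shows "continuous_on A (\<lambda>x. heat_profile b (f x) (g x))"
proof -
  have "continuous_on A (\<lambda>x. f x powr (- b) * heat_profile b 1 (g x / f x))"
    using assms by (intro continuous_intros continuous_on_compose2 [OF continuous_on_heat_profile_1])
      (auto simp: less_imp_neq [symmetric] dest: less_imp_neq)
  then show ?thesis
    by (rule continuous_on_eq) (simp add: assms(3) flip: heat_profile_scale)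
qed

section \<open>Integrals of the profiles\<close>

lemma borel_measurable_heat_profile [measurable]:
  "heat_profile b a \<in> borel_measurable borel"
  unfolding heat_profile_def by measurable

text \<open>The inversion \<open>t = 1 / s\<close> turns the integral into Euler's integral of
  \<open>t powr (b - 2) * exp (- t)\<close>, convergent at 0 because
  \<open>b - 1 > 0\<close>.\<close>

lemma has_bochner_integral_heat_profile:
  assumes "b > 1"
  shows "has_bochner_integral lborel (heat_profile b 1) (Gamma (b - 1))"
proof -
  let ?f = "\<lambda>t::real. t powr (b - 2) / exp t"
  let ?S = "{0<..} :: real set"
  have "(?f has_integral Gamma (b - 1)) {0..}"
    using Gamma_integral_real [of "b - 1"] assms by simp
  \<comment> \<open>The end point 0 is dropped so that \<open>1 / x\<close> is a bijection of the
    domain.\<close>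
  then have f: "(?f has_integral Gamma (b - 1)) ?S"
    by (rule has_integral_spike_set_eq [THEN iffD1, rotated -1])
      (auto intro: negligible_subset [of "{0}"])
  then have "?f absolutely_integrable_on ?S"
    by (intro nonnegative_absolutely_integrable_1) (auto simp: integrable_on_def)
  moreover have "x \<in> (\<lambda>x. 1 / x) ` ?S" if "x > 0" for x :: real
    using that by (intro image_eqI [of _ _ "1 / x"]) auto
  then have "(\<lambda>x::real. 1 / x) ` ?S = ?S"
    by auto
  ultimately have *: "(\<lambda>x. \<bar>- (1 / x\<^sup>2)\<bar> * ?f (1 / x)) absolutely_integrable_on ?S \<and>
      integral ?S (\<lambda>x. \<bar>- (1 / x\<^sup>2)\<bar> * ?f (1 / x)) = Gamma (b - 1)"
    using f
    by (subst has_absolute_integral_change_of_variables_1')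
      (auto intro!: derivative_eq_intros inj_onI integral_unique simp: power2_eq_square field_simps)
  have eq: "\<bar>- (1 / x\<^sup>2)\<bar> * ?f (1 / x) = heat_profile b 1 x" if "x \<in> ?S" for x
    using that by (simp add: heat_profile_def powr_divide powr_diff powr_minus exp_minus field_simps
        powr_numeral)
  have "heat_profile b 1 absolutely_integrable_on ?S \<longleftrightarrow>
      (\<lambda>x. \<bar>- (1 / x\<^sup>2)\<bar> * ?f (1 / x)) absolutely_integrable_on ?S"
    by (intro set_integrable_cong refl eq [symmetric])
  moreover have "integral ?S (heat_profile b 1) = integral ?S (\<lambda>x. \<bar>- (1 / x\<^sup>2)\<bar> * ?f (1 / x))"
    by (intro Henstock_Kurzweil_Integration.integral_cong eq [symmetric])
  ultimately have "heat_profile b 1 absolutely_integrable_on ?S"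
    "integral ?S (heat_profile b 1) = Gamma (b - 1)"
    using * by auto
  then have "integrable lebesgue (\<lambda>x. indicator ?S x *\<^sub>R heat_profile b 1 x)"
     "(LINT x:?S|lebesgue. heat_profile b 1 x) = Gamma (b - 1)"
    using set_lebesgue_integral_eq_integral(2) [of ?S "heat_profile b 1"] by (simp_all add: set_integrable_def)
  moreover have "(\<lambda>x. indicator ?S x *\<^sub>R heat_profile b 1 x) = heat_profile b 1"
    by (auto simp: indicator_def fun_eq_iff)
  ultimately show ?thesis
    by (simp add: set_lebesgue_integral_def has_bochner_integral_iff integrable_completion
        integral_completion)
qed

section \<open>Weak derivatives on the half line\<close>

text \<open>A class of functions that contains the bump functions below and is closed under
  differentiation; hence all its members are smooth.\<close>

inductive_set bump_span :: "real \<Rightarrow> real \<Rightarrow> real \<Rightarrow> (real \<Rightarrow> real) set" for a b n :: real where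
  base: "0 \<le> c \<Longrightarrow> 0 \<le> d \<Longrightarrow>
    (\<lambda>x. heat_profile c 1 (n * (x - a)) * heat_profile d 1 (n * (b - x))) \<in> bump_span a b n"
| add: "f \<in> bump_span a b n \<Longrightarrow> g \<in> bump_span a b n \<Longrightarrow> (\<lambda>x. f x + g x) \<in> bump_span a b n"
| cmult: "f \<in> bump_span a b n \<Longrightarrow> (\<lambda>x. r * f x) \<in> bump_span a b n"

text \<open>Differentiating a profile only raises its exponent, so products with nonnegative
  exponents yield sums of such products.\<close>

lemma bump_span_deriv:
  assumes "f \<in> bump_span a b n"
  shows "\<exists>f'\<in>bump_span a b n. \<forall>x. (f has_real_derivative f' x) (at x)"
  using assms
proof induction
  case (base c d)
  let ?p = "\<lambda>c d x. heat_profile c 1 (n * (x - a)) * heat_profile d 1 (n * (b - x))"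
  let ?f' = "\<lambda>x. (n * (- c) * ?p (c + 1) d x + n * ?p (c + 2) d x)
      + (n * d * ?p c (d + 1) x + (- n) * ?p c (d + 2) x)"
  have "((\<lambda>x. heat_profile c 1 (n * (x - a))) has_real_derivative
      (- c * heat_profile (c + 1) 1 (n * (x - a)) + heat_profile (c + 2) 1 (n * (x - a))) * n) (at x)"
    for x
    using base by (intro DERIV_chain2 [OF DERIV_heat_profile_1]) (auto intro!: derivative_eq_intros)
  moreover have "((\<lambda>x. heat_profile d 1 (n * (b - x))) has_real_derivative
      (- d * heat_profile (d + 1) 1 (n * (b - x)) + heat_profile (d + 2) 1 (n * (b - x))) * (- n)) (at x)"
    for x
    using base by (intro DERIV_chain2 [OF DERIV_heat_profile_1]) (auto intro!: derivative_eq_intros)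
  ultimately have "(?p c d has_real_derivative ?f' x) (at x)" for x
    by (rule DERIV_cong [OF DERIV_mult]) (simp add: algebra_simps)
  moreover have "?f' \<in> bump_span a b n"
    using base by (intro bump_span.intros) auto
  ultimately show ?case
    by (intro bexI [where x = ?f'] allI)
next
  case (add f g)
  then obtain f' g' where "f' \<in> bump_span a b n" "g' \<in> bump_span a b n"
    "\<forall>x. (f has_real_derivative f' x) (at x)" "\<forall>x. (g has_real_derivative g' x) (at x)"
    by blast
  then show ?case
    by (intro bexI [where x = "\<lambda>x. f' x + g' x"] bump_span.add) (auto intro: DERIV_add)
next
  case (cmult f r)
  then obtain f' where "f' \<in> bump_span a b n" "\<forall>x. (f has_real_derivative f' x) (at x)"
    by blast
  then show ?case
    by (intro bexI [where x = "\<lambda>x. r * f' x"] bump_span.cmult) (auto intro: DERIV_cmult)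
qed

lemma bump_span_smooth:
  assumes "f \<in> bump_span a b n"
  shows "(deriv ^^ k) f differentiable at x"
proof -
  have "(deriv ^^ k) f \<in> bump_span a b n"
  proof (induction k)
    case (Suc k)
    then obtain f' where "f' \<in> bump_span a b n" "\<And>x. ((deriv ^^ k) f has_real_derivative f' x) (at x)"
      using bump_span_deriv by blast
    moreover from this have "deriv ((deriv ^^ k) f) = f'"
      by (intro ext DERIV_imp_deriv)
    ultimately show ?case by simp
  qed (use assms in simp)
  then show ?thesis
    using bump_span_deriv real_differentiable_def by blast
qed

text \<open>On \<open>{a<..<b}\<close> this is the product of
  \<open>exp (- 1 / ((n + 1) * (x - a)))\<close> and \<open>exp (- 1 / ((n + 1) * (b - x)))\<close>.
  Growing \<open>n\<close> pushes both factors up to 1, so the bumps approximate the indicator of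
  the interval.\<close>

definition bump :: "real \<Rightarrow> real \<Rightarrow> nat \<Rightarrow> real \<Rightarrow> real" where
  "bump a b n x = heat_profile 0 1 (real (Suc n) * (x - a)) * heat_profile 0 1 (real (Suc n) * (b - x))"

lemma bump_eq_0: "x \<notin> {a<..<b} \<Longrightarrow> bump a b n x = 0"
  unfolding bump_def
  by (cases "x \<le> a") (auto simp: mult_le_0_iff)

lemma abs_bump_le: "\<bar>bump a b n x\<bar> \<le> 1"
proof -
  have "\<bar>heat_profile 0 1 s\<bar> \<le> 1" for s
    by (simp add: heat_profile_def)
  then show ?thesis
    unfolding bump_def abs_mult by (intro mult_le_one) auto
qed

lemma borel_measurable_bump [measurable]: "bump a b n \<in> borel_measurable borel"
  unfolding bump_def by measurable

lemma bump_test_function: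
  assumes "{a..b} \<subseteq> S"
  shows "bump a b n \<in> test_functions S"
proof -
  have "bump a b n \<in> bump_span a b (real (Suc n))"
    using bump_span.base [of 0 0 "real (Suc n)" a b] by (simp add: bump_def [abs_def])
  then show ?thesis
    unfolding test_functions_def using assms bump_span_smooth
    by (auto intro!: exI [of _ "{a..b}"] bump_eq_0)
qed

lemma bump_tendsto: "(\<lambda>n. bump a b n x) \<longlonglongrightarrow> indicator {a<..<b} x"
proof (cases "x \<in> {a<..<b}")
  case True
  have *: "(\<lambda>n. heat_profile 0 1 (real (Suc n) * y)) \<longlonglongrightarrow> 1" if "y > 0" for y
  proof -
    have "(\<lambda>n. exp (- 1 / y * (1 / real (Suc n)))) \<longlonglongrightarrow> exp (- 1 / y * 0)"
      by (intro tendsto_intros LIMSEQ_Suc lim_1_over_n)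
    then show ?thesis
      using that by (simp add: heat_profile_def mult.commute)
  qed
  have "(\<lambda>n. bump a b n x) \<longlonglongrightarrow> 1 * 1"
    unfolding bump_def using True by (intro tendsto_mult *) auto
  then show ?thesis
    using True by simp
qed (simp add: bump_eq_0)

section \<open>Uniqueness of weak derivatives\<close>

lemma AE_eq_0_if_integral_atMost_eq_0:
  fixes f :: "real \<Rightarrow> real"
  assumes f: "integrable lborel f"
    and 0: "(LINT x|lborel. f x) = 0" "\<And>t. (LINT x:{..t}|lborel. f x) = 0"
  shows "AE x in lborel. f x = 0"
proof (rule density_unique_real [OF f])
  fix A :: "real set"
  assume "A \<in> sets lborel"
  then have "A \<in> sigma_sets UNIV (range atMost)"
    by (simp add: borel_eq_atMost)
  have "Int_stable (range (atMost :: real \<Rightarrow> _))" "range atMost \<subseteq> Pow (UNIV :: real set)"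
    by (auto simp: Int_stable_def)
  have sets: "sigma_sets UNIV (range atMost) = sets (borel :: real measure)"
    by (simp add: borel_eq_atMost)
  have int: "set_integrable lborel B f" if "B \<in> sets borel" for B
    using f that unfolding set_integrable_def by (intro integrable_mult_indicator) auto
  \<comment> \<open>Dynkin's argument: the half-lines are closed under intersection and generate the
    Borel sets. Complements are covered by the vanishing total integral, disjoint unions by
    countable additivity.\<close>
  have "(LINT x:A|lborel. f x) = 0"
    using \<open>Int_stable _\<close> \<open>range _ \<subseteq> _\<close> \<open>A \<in> sigma_sets _ _\<close>
  proof (induction rule: sigma_sets_induct_disjoint)
    case (compl A)
    then have "A \<in> sets borel" by (simp add: sets)
    then have "(LINT x:A \<union> (UNIV - A)|lborel. f x) = (LINT x:A|lborel. f x) + (LINT x:UNIV - A|lborel. f x)"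
      by (intro set_integral_Un int) auto
    then show ?case
      using compl 0(1) by (simp add: set_lebesgue_integral_def)
  next
    case (union A)
    then have *: "A i \<in> sets borel" for i
      by (auto simp: sets)
    then have "(LINT x:(\<Union>i. A i)|lborel. f x) = (\<Sum>i. LINT x:A i|lborel. f x)"
      using union(1) by (intro lebesgue_integral_countable_add int) (auto simp: disjoint_family_on_def)
    then show ?case
      using union by simp
  qed (use 0 in \<open>auto simp: set_lebesgue_integral_def\<close>)
  then show "(LINT x:A|lborel. f x) = (LINT x:A|lborel. 0)"
    by simp
qed auto

text \<open>The fundamental lemma of the calculus of variations. Bumps converge boundedly to
  indicators, so by dominated convergence \<open>g\<close> has integral zero over every open
  interval whose closure lies in \<open>S\<close>; this determines its integrals over all Borel
  subsets of \<open>{c..d}\<close>.\<close>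

lemma AE_eq_0_on_Icc_if_orthogonal:
  assumes sub: "{c..d} \<subseteq> S" and S: "S \<in> sets lebesgue" and g: "locally_integrable_on g S"
    and 0: "\<And>\<phi>. \<phi> \<in> test_functions S \<Longrightarrow> (LINT x:S|lebesgue. g x * \<phi> x) = 0"
  shows "AE x in lebesgue. x \<in> {c..d} \<longrightarrow> g x = 0"
proof -
  have int: "set_integrable lebesgue {a..b} g" if "{a..b} \<subseteq> S" for a b
    using g that by (simp add: locally_integrable_on_def)
  have Ioo: "(LINT x|lebesgue. indicator {a<..<b} x * g x) = 0" if ab: "{a..b} \<subseteq> S" for a b
  proof -
    have [measurable]: "(\<lambda>x. indicator {a..b} x * g x) \<in> borel_measurable lebesgue"
      using int [OF ab] by (auto simp: set_integrable_def)
    have [measurable]: "(\<lambda>x. indicator {a<..<b} x :: real) \<in> borel_measurable lebesgue"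
      "bump a b n \<in> borel_measurable lebesgue" for n
      by (auto intro!: measurable_completion)
    have eq: "indicator {a<..<b} x * g x = indicator {a<..<b} x * (indicator {a..b} x * g x)" for x
      by (auto simp: indicator_def)
    have "(\<lambda>n. LINT x|lebesgue. bump a b n x * (indicator {a..b} x * g x)) \<longlonglongrightarrow>
        (LINT x|lebesgue. indicator {a<..<b} x * (indicator {a..b} x * g x))"
    proof (rule integral_dominated_convergence [where w = "\<lambda>x. \<bar>indicator {a..b} x * g x\<bar>"])
      show "integrable lebesgue (\<lambda>x. \<bar>indicator {a..b} x * g x\<bar>)"
        using int [OF ab] by (auto simp: set_integrable_def)
      show "AE x in lebesgue. (\<lambda>n. bump a b n x * (indicator {a..b} x * g x))
          \<longlonglongrightarrow> indicator {a<..<b} x * (indicator {a..b} x * g x)"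
        by (intro AE_I2 tendsto_mult bump_tendsto tendsto_const)
      show "AE x in lebesgue. norm (bump a b n x * (indicator {a..b} x * g x)) \<le> \<bar>indicator {a..b} x * g x\<bar>"
        for n
        by (intro AE_I2) (simp add: abs_mult abs_bump_le mult_left_le_one_le)
    qed measurable
    moreover have "bump a b n x * (indicator {a..b} x * g x) = indicator S x *\<^sub>R (g x * bump a b n x)"
      for n x
    proof (cases "x \<in> {a<..<b}")
      case True
      then have "x \<in> S" using ab by auto
      with True show ?thesis by simp
    qed (simp add: bump_eq_0)
    ultimately have "(\<lambda>n. 0) \<longlonglongrightarrow> (LINT x|lebesgue. indicator {a<..<b} x * (indicator {a..b} x * g x))"
      using 0 [OF bump_test_function [OF ab]] by (simp add: set_lebesgue_integral_def)
    then show ?thesis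
      unfolding eq using LIMSEQ_unique tendsto_const by metis
  qed
  let ?f = "\<lambda>x. indicator {c..d} x * g x"
  have f: "integrable lebesgue ?f"
    using int [OF sub] by (simp add: set_integrable_def)
  \<comment> \<open>The Dynkin argument works with Borel sets, while \<open>g\<close> is only
    Lebesgue measurable; hence the passage to a Borel function that agrees almost
    everywhere.\<close>
  then obtain f' where f': "f' \<in> borel_measurable lborel" "AE x in lborel. ?f x = f' x"
    using completion_ex_borel_measurable_real borel_measurable_integrable by blast
  have AE: "AE x in lebesgue. ?f x = f' x"
    using f'(2) by (rule AE_completion)
  have f'_leb: "f' \<in> borel_measurable lebesgue"
    using f'(1) by (rule measurable_completion)
  have "integrable lebesgue f'"
    using f f'_leb AE by (rule integrable_cong_AE_imp)
  then have int': "integrable lborel f'"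
    using f'(1) by (simp add: integrable_completion)
  have null: "AE x in lebesgue. x \<noteq> c \<and> x \<noteq> d \<and> x \<noteq> t" for t :: real
    by (intro AE_completion AE_conjI AE_lborel_singleton)
  have *: "(LINT x|lborel. indicator {..t} x * f' x) = 0" for t
  proof -
    have m: "(\<lambda>x. indicator {..t} x * f' x) \<in> borel_measurable lborel"
      using f'(1) by measurable
    \<comment> \<open>Up to end points, \<open>{..t}\<close> cuts \<open>{c..d}\<close> down to
      \<open>{c<..<min d t}\<close>, which is empty for \<open>t < c\<close>.\<close>
    have sub': "{c..min d t} \<subseteq> S" using sub by auto
    have "(LINT x|lborel. indicator {..t} x * f' x) = (LINT x|lebesgue. indicator {..t} x * f' x)"
      using m by (simp add: integral_completion)
    also have "\<dots> = (LINT x|lebesgue. indicator {c<..<min d t} x * g x)"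
    proof (rule integral_cong_AE)
      show "(\<lambda>x. indicator {..t} x * f' x) \<in> borel_measurable lebesgue"
        using m by (rule measurable_completion)
      have "(\<lambda>x. indicator {c<..<min d t} x *\<^sub>R (indicator {c..min d t} x *\<^sub>R g x)) \<in> borel_measurable lebesgue"
        using int [OF sub'] unfolding set_integrable_def
        by (intro borel_measurable_scaleR [OF _ borel_measurable_integrable] measurable_completion) auto
      then show "(\<lambda>x. indicator {c<..<min d t} x * g x) \<in> borel_measurable lebesgue"
        by (rule measurable_cong [THEN iffD1, rotated]) (auto simp: indicator_def)
      show "AE x in lebesgue. indicator {..t} x * f' x = indicator {c<..<min d t} x * g x"
        using AE null [of t] by eventually_elim (auto simp: indicator_def split: if_splits)
    qed
    also have "\<dots> = 0"
      by (rule Ioo [OF sub'])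
    finally show ?thesis .
  qed
  have "(LINT x|lborel. f' x) = (LINT x|lebesgue. f' x)"
    using f'(1) by (simp add: integral_completion)
  \<comment> \<open>Beyond \<open>d\<close> the function vanishes almost everywhere, so the total
    integral is the case \<open>t = d\<close>.\<close>
  also have "\<dots> = (LINT x|lebesgue. indicator {..d} x * f' x)"
    using f'(1) AE by (intro integral_cong_AE f'_leb measurable_completion [OF borel_measurable_times])
       (auto elim!: eventually_mono simp: indicator_def split: if_splits)
  also have "\<dots> = 0"
    using * [of d] f'(1) by (subst integral_completion) auto
  finally have "AE x in lborel. f' x = 0"
    using * int' by (intro AE_eq_0_if_integral_atMost_eq_0) (auto simp: set_lebesgue_integral_def)
  then have "AE x in lebesgue. f' x = 0"
    by (rule AE_completion)
  with AE show ?thesis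
    by eventually_elim (auto simp: indicator_def)
qed

text \<open>A test function is bounded and supported in a compact set, on which \<open>g\<close> is
  integrable. This justifies splitting the integral of a difference below.\<close>

lemma test_function_mult_integrable:
  assumes \<phi>: "\<phi> \<in> test_functions S" and g: "locally_integrable_on g S"
  shows "set_integrable lebesgue S (\<lambda>x. g x * \<phi> x)"
proof -
  obtain K where K: "compact K" "K \<subseteq> S" "\<And>x. x \<notin> K \<Longrightarrow> \<phi> x = 0"
    using \<phi> by (auto simp: test_functions_def)
  have "(deriv ^^ 0) \<phi> differentiable at x" for x
    using \<phi> unfolding test_functions_def by blast
  then have cont: "continuous_on A \<phi>" for A
    by (simp add: differentiable_at_withinI differentiable_imp_continuous_on differentiable_on_def)
  then obtain B where B: "\<And>x. x \<in> K \<Longrightarrow> \<bar>\<phi> x\<bar> \<le> B"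
    using compact_imp_bounded [OF compact_continuous_image [OF cont K(1)]]
    by (auto simp: bounded_iff)
  have g': "integrable lebesgue (\<lambda>x. indicator K x *\<^sub>R g x)"
    using g K by (auto simp: locally_integrable_on_def set_integrable_def)
  have "integrable lebesgue (\<lambda>x. \<phi> x * (indicator K x *\<^sub>R g x))"
  proof (rule Bochner_Integration.integrable_bound)
    show "integrable lebesgue (\<lambda>x. B * (indicator K x *\<^sub>R g x))"
      using g' by (rule integrable_mult_right)
    have "\<phi> \<in> borel_measurable lebesgue"
      using borel_measurable_continuous_onI [OF cont] by (intro measurable_completion) simp
    then show "(\<lambda>x. \<phi> x * (indicator K x *\<^sub>R g x)) \<in> borel_measurable lebesgue"
      using borel_measurable_integrable [OF g'] by (rule borel_measurable_times)
    have "norm (\<phi> x * (indicator K x *\<^sub>R g x)) \<le> norm (B * (indicator K x *\<^sub>R g x))" for x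
      using B [of x] by (cases "x \<in> K") (auto simp: abs_mult intro!: mult_right_mono)
    then show "AE x in lebesgue. norm (\<phi> x * (indicator K x *\<^sub>R g x)) \<le> norm (B * (indicator K x *\<^sub>R g x))"
      by simp
  qed
  moreover have "(\<lambda>x. \<phi> x * (indicator K x *\<^sub>R g x)) = (\<lambda>x. indicator S x *\<^sub>R (g x * \<phi> x))"
    using K by (auto simp: indicator_def fun_eq_iff)
  ultimately show ?thesis
    by (simp only: set_integrable_def)
qed

text \<open>The difference is orthogonal to all test functions, hence null on each compact interval.
  Countably many intervals \<open>{1 / real (Suc n)..real n}\<close> exhaust the half-line, so the
  exceptional sets remain null in total.\<close>

lemma has_weak_deriv_unique:
  assumes g: "has_weak_deriv {0<..} f g" and h: "has_weak_deriv {0<..} f h"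
  shows "AE x in lebesgue. x > 0 \<longrightarrow> g x = h x"
proof -
  have loc: "locally_integrable_on g {0<..}" "locally_integrable_on h {0<..}"
    using g h by (auto simp: has_weak_deriv_def)
  then have loc': "locally_integrable_on (\<lambda>x. g x - h x) {0<..}"
    by (auto simp: locally_integrable_on_def)
  have "(LINT x:{0<..}|lebesgue. (g x - h x) * \<phi> x) = 0" if \<phi>: "\<phi> \<in> test_functions {0<..}" for \<phi>
  proof -
    have "(LINT x:{0<..}|lebesgue. g x * \<phi> x) = (LINT x:{0<..}|lebesgue. h x * \<phi> x)"
      using g h \<phi> by (simp add: has_weak_deriv_def)
    then show ?thesis
      using test_function_mult_integrable [OF \<phi> loc(1)] test_function_mult_integrable [OF \<phi> loc(2)]
      by (simp add: left_diff_distrib)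
  qed
  then have *: "AE x in lebesgue. x \<in> {1 / real (Suc n)..real n} \<longrightarrow> g x - h x = 0" for n
    by (intro AE_eq_0_on_Icc_if_orthogonal [OF _ _ loc'])
      (auto intro: less_le_trans [of 0 "1 / (1 + real n)"])
  have **: "AE x in lebesgue. \<forall>n. x \<in> {1 / real (Suc n)..real n} \<longrightarrow> g x - h x = 0"
    unfolding AE_all_countable using * by blast
  have ex: "\<exists>n. x \<in> {1 / real (Suc n)..real n}" if "x > 0" for x
  proof -
    obtain n where "max x (1 / x) \<le> real n"
      using real_arch_simple by blast
    then have "x \<in> {1 / real (Suc n)..real n}"
      using that by (auto simp: field_simps)
    then show ?thesis ..
  qed
  show ?thesis
    using ** by eventually_elim (use ex in force)
qed

section \<open>Classical derivatives as weak derivatives, and Sobolev norms\<close>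

lemma continuous_imp_locally_integrable_on:
  assumes "continuous_on S f"
  shows "locally_integrable_on f S"
  unfolding locally_integrable_on_def set_integrable_def
proof safe
  fix K assume "compact K" "K \<subseteq> S"
  then have "integrable lborel (\<lambda>x. indicator K x *\<^sub>R f x)"
    using assms by (intro borel_integrable_compact) (auto intro: continuous_on_subset)
  then show "integrable lebesgue (\<lambda>x. indicator K x *\<^sub>R f x)"
    by (subst integrable_completion) auto
qed

text \<open>Integration by parts on a compact interval that contains the support of the test
  function in its interior.\<close>

lemma has_weak_deriv_if_C1:
  assumes f: "\<And>x. x > 0 \<Longrightarrow> (f has_real_derivative g x) (at x)"
    and g: "continuous_on {0<..} g"
  shows "has_weak_deriv {0<..} f g"
  unfolding has_weak_deriv_def
proof (intro conjI ballI)
  have cf: "continuous_on {0<..} f"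
    using f by (meson DERIV_isCont continuous_at_imp_continuous_on greaterThan_iff)
  then show "locally_integrable_on f {0<..}"
    by (rule continuous_imp_locally_integrable_on)
  show "locally_integrable_on g {0<..}"
    using g by (rule continuous_imp_locally_integrable_on)
  fix \<phi> assume \<phi>: "\<phi> \<in> test_functions {0<..}"
  then obtain K where K: "compact K" "K \<subseteq> {0<..}" "\<And>x. x \<notin> K \<Longrightarrow> \<phi> x = 0"
    by (auto simp: test_functions_def)
  have D: "(deriv ^^ n) \<phi> differentiable at x" for n x
    using \<phi> unfolding test_functions_def by blast
  have d\<phi>: "(\<phi> has_real_derivative deriv \<phi> x) (at x)" for x
    using D [of 0 x] by (simp add: DERIV_deriv_iff_real_differentiable)
  have c\<phi>: "continuous_on A \<phi>" for A
    using d\<phi> by (meson DERIV_isCont continuous_at_imp_continuous_on)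
  have cd\<phi>: "continuous_on A (deriv \<phi>)" for A
    using D [of 1] by (intro continuous_at_imp_continuous_on ballI)
      (auto simp: differentiable_imp_continuous_within)
  have d0: "deriv \<phi> x = 0" if "x \<notin> K" for x
  proof -
    have "((\<lambda>x. 0) has_real_derivative 0) (at x)" by simp
    then have "(\<phi> has_real_derivative 0) (at x)"
      by (rule has_field_derivative_transform_within_open [where S = "- K"])
        (use that K compact_imp_closed in auto)
    then show ?thesis by (rule DERIV_imp_deriv)
  qed
  \<comment> \<open>The strict margins make the test function vanish at \<open>a\<close> and
    \<open>b\<close>, which removes the boundary terms.\<close>
  obtain a b where ab: "0 < a" "a \<le> b" "K \<subseteq> {a<..<b}"
  proof (cases "K = {}")
    case True
    show ?thesis by (rule that [of 1 1]) (auto simp: True)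
  next
    case False
    then obtain u v where uv: "u \<in> K" "\<And>x. x \<in> K \<Longrightarrow> u \<le> x" "v \<in> K" "\<And>x. x \<in> K \<Longrightarrow> x \<le> v"
      using compact_attains_inf compact_attains_sup K(1) by metis
    have "u > 0" "u \<le> v"
      using K(2) uv by auto
    then have "0 < u / 2" "u / 2 \<le> v + 1" "x \<in> {u / 2<..<v + 1}" if "x \<in> K" for x
      using uv(2,4) [OF that] by auto
    with uv(1) show ?thesis
      by (intro that [of "u / 2" "v + 1"]) blast+
  qed
  have int: "(LINT x:{0<..}|lebesgue. h x) = integral {a..b} h \<and> h integrable_on {a..b}"
    if h: "continuous_on {0<..} h" and 0: "\<And>x. x \<notin> K \<Longrightarrow> h x = 0" for h :: "real \<Rightarrow> real"
  proof -
    have "(\<lambda>x. indicator {0<..} x *\<^sub>R h x) = (\<lambda>x. indicator {a..b} x *\<^sub>R h x)"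
    proof
      fix x
      show "indicator {0<..} x *\<^sub>R h x = indicator {a..b} x *\<^sub>R h x"
        using ab K(2) 0 [of x] by (cases "x \<in> K") (auto simp: indicator_def)
    qed
    then have "(LINT x:{0<..}|lebesgue. h x) = (LINT x:{a..b}|lebesgue. h x)"
      by (simp add: set_lebesgue_integral_def)
    moreover have "{a..b} \<subseteq> {0<..}"
      using ab(1) by auto
    then have "set_integrable lebesgue {a..b} h"
      using continuous_imp_locally_integrable_on [OF h] compact_Icc [of a b]
      unfolding locally_integrable_on_def by blast
    ultimately show ?thesis
      using set_lebesgue_integral_eq_integral by metis
  qed
  have f\<phi>: "(LINT x:{0<..}|lebesgue. f x * deriv \<phi> x) = integral {a..b} (\<lambda>x. f x * deriv \<phi> x) \<and>
      (\<lambda>x. f x * deriv \<phi> x) integrable_on {a..b}"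
    by (intro int continuous_intros cf cd\<phi>) (simp add: d0)
  have g\<phi>: "(LINT x:{0<..}|lebesgue. g x * \<phi> x) = integral {a..b} (\<lambda>x. g x * \<phi> x) \<and>
      (\<lambda>x. g x * \<phi> x) integrable_on {a..b}"
    by (intro int continuous_intros g c\<phi>) (simp add: K)
  have "((\<lambda>x. f x * \<phi> x) has_vector_derivative f x * deriv \<phi> x + g x * \<phi> x) (at x within {a..b})"
    if "x \<in> {a..b}" for x
  proof -
    have "((\<lambda>x. f x * \<phi> x) has_real_derivative f x * deriv \<phi> x + g x * \<phi> x) (at x)"
      by (rule DERIV_cong [OF DERIV_mult [OF f d\<phi>]]) (use that ab(1) in auto)
    then show ?thesis
      using has_field_derivative_at_within has_real_derivative_iff_has_vector_derivative by blast
  qed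
  then have "((\<lambda>x. f x * deriv \<phi> x + g x * \<phi> x) has_integral (f b * \<phi> b - f a * \<phi> a)) {a..b}"
    by (rule fundamental_theorem_of_calculus [OF ab(2)])
  moreover have "a \<notin> K" "b \<notin> K"
    using ab(3) by auto
  ultimately have "integral {a..b} (\<lambda>x. f x * deriv \<phi> x + g x * \<phi> x) = 0"
    by (simp add: integral_unique K(3))
  then show "(LINT x:{0<..}|lebesgue. f x * deriv \<phi> x) = - (LINT x:{0<..}|lebesgue. g x * \<phi> x)"
    using f\<phi> g\<phi> by (simp add: integral_add)
qed

lemma Lp_space_if_dominated:
  assumes S: "S \<in> sets lebesgue" and f: "set_borel_measurable lebesgue S f"
    and w: "set_integrable lebesgue S w" and le: "\<And>x. x \<in> S \<Longrightarrow> \<bar>f x\<bar> powr q \<le> w x"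
    and q: "q > 0"
  shows "f \<in> Lp_space q S" and "Lp_norm q S f powr q \<le> (LINT x:S|lebesgue. w x)"
proof -
  \<comment> \<open>Measurability is known for the truncated function; truncation commutes with the
    power because \<open>0 powr q = 0\<close>.\<close>
  have "(\<lambda>x. \<bar>indicator S x *\<^sub>R f x\<bar> powr q) \<in> borel_measurable lebesgue"
    using f unfolding set_borel_measurable_def by measurable
  moreover have "(\<lambda>x. \<bar>indicator S x *\<^sub>R f x\<bar> powr q) = (\<lambda>x. indicator S x *\<^sub>R \<bar>f x\<bar> powr q)"
    by (auto simp: indicator_def)
  ultimately have *: "set_integrable lebesgue S (\<lambda>x. \<bar>f x\<bar> powr q)"
    using w le unfolding set_integrable_def
    by (elim Bochner_Integration.integrable_bound) (force simp: indicator_def)+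
  then show "f \<in> Lp_space q S"
    using f by (simp add: Lp_space_def)
  have "0 \<le> (LINT x:S|lebesgue. \<bar>f x\<bar> powr q)"
    unfolding set_lebesgue_integral_def by (rule Bochner_Integration.integral_nonneg) auto
  then have "Lp_norm q S f powr q = (LINT x:S|lebesgue. \<bar>f x\<bar> powr q)"
    using q by (simp add: Lp_norm_def powr_powr)
  also have "\<dots> \<le> (LINT x:S|lebesgue. w x)"
    by (rule set_integral_mono [OF * w le])
  finally show "Lp_norm q S f powr q \<le> (LINT x:S|lebesgue. w x)" .
qed

text \<open>By uniqueness, whatever representative \<open>weak_deriv\<close> chooses agrees almost
  everywhere with \<open>g\<close>, so the norm can be computed with \<open>g\<close>. The factor 2
  counts the two terms of the norm, each at most the integral of the common majorant
  \<open>w\<close>.\<close>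

lemma W1_if_C1_dominated:
  assumes f: "\<And>x. x > 0 \<Longrightarrow> (f has_real_derivative g x) (at x)"
    and g: "continuous_on {0<..} g"
    and w: "set_integrable lebesgue {0<..} w"
    and f_le: "\<And>x. x > 0 \<Longrightarrow> \<bar>f x\<bar> powr q \<le> w x"
    and g_le: "\<And>x. x > 0 \<Longrightarrow> \<bar>g x\<bar> powr q \<le> w x"
    and q: "q > 0"
  shows "f \<in> W1_space q {0<..}"
    and "W1_norm q {0<..} f \<le> (2 * (LINT x:{0<..}|lebesgue. w x)) powr (1 / q)"
proof -
  let ?S = "{0<..} :: real set"
  have meas: "set_borel_measurable lebesgue ?S h" if "continuous_on ?S h" for h :: "real \<Rightarrow> real"
    using borel_measurable_continuous_on_indicator [OF _ that] unfolding set_borel_measurable_def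
    by (intro measurable_completion) simp
  have cf: "continuous_on ?S f"
    using f by (meson DERIV_isCont continuous_at_imp_continuous_on greaterThan_iff)
  have fg: "has_weak_deriv ?S f g"
    by (rule has_weak_deriv_if_C1 [OF f g])
  have Lf: "f \<in> Lp_space q ?S" "Lp_norm q ?S f powr q \<le> (LINT x:?S|lebesgue. w x)"
    by (rule Lp_space_if_dominated [OF _ meas [OF cf] w f_le q]; simp)+
  have Lg: "g \<in> Lp_space q ?S" "Lp_norm q ?S g powr q \<le> (LINT x:?S|lebesgue. w x)"
    by (rule Lp_space_if_dominated [OF _ meas [OF g] w g_le q]; simp)+
  show "f \<in> W1_space q ?S"
    using Lf Lg fg by (auto simp: W1_space_def)
  have wd: "has_weak_deriv ?S f (weak_deriv ?S f)"
    unfolding weak_deriv_def by (rule someI [of _ g]) (rule fg)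
  have AE: "AE x in lebesgue. x > 0 \<longrightarrow> weak_deriv ?S f x = g x"
    by (rule has_weak_deriv_unique [OF wd fg])
  have "Lp_norm q ?S (weak_deriv ?S f) = Lp_norm q ?S g"
  proof -
    \<comment> \<open>Measurability passes to the chosen representative because Lebesgue measure is
      complete.\<close>
    have mw: "set_borel_measurable lebesgue ?S (weak_deriv ?S f)"
    proof -
      have "(\<lambda>x. indicator ?S x *\<^sub>R g x) \<in> borel_measurable lebesgue"
        using meas [OF g] by (simp add: set_borel_measurable_def)
      moreover have "AE x in lebesgue. indicator ?S x *\<^sub>R g x = indicator ?S x *\<^sub>R weak_deriv ?S f x"
        using AE by eventually_elim (auto simp: indicator_def)
      ultimately show ?thesis
        unfolding set_borel_measurable_def
        by (rule borel_measurable_AE)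
    qed
    have m: "(\<lambda>x. indicator ?S x *\<^sub>R \<bar>h x\<bar> powr q) \<in> borel_measurable lebesgue"
      if "set_borel_measurable lebesgue ?S h" for h
    proof -
      have "(\<lambda>x. \<bar>indicator ?S x *\<^sub>R h x\<bar> powr q) \<in> borel_measurable lebesgue"
        using that unfolding set_borel_measurable_def by measurable
      moreover have "(\<lambda>x. \<bar>indicator ?S x *\<^sub>R h x\<bar> powr q) = (\<lambda>x. indicator ?S x *\<^sub>R \<bar>h x\<bar> powr q)"
        by (auto simp: indicator_def)
      ultimately show ?thesis by simp
    qed
    have "(LINT x:?S|lebesgue. \<bar>weak_deriv ?S f x\<bar> powr q) = (LINT x:?S|lebesgue. \<bar>g x\<bar> powr q)"
      unfolding set_lebesgue_integral_def
      by (intro integral_cong_AE m mw meas g) (use AE in \<open>auto elim!: eventually_mono simp: indicator_def\<close>)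
    then show ?thesis
      by (simp add: Lp_norm_def)
  qed
  then show "W1_norm q ?S f \<le> (2 * (LINT x:?S|lebesgue. w x)) powr (1 / q)"
    unfolding W1_norm_def using Lf(2) Lg(2) q by (intro powr_mono2) auto
qed

section \<open>The boundary potential\<close>

text \<open>For \<open>s \<ge> 0\<close> this is
  \<open>- 2 * deriv (heat_kernel s) x\<close>.\<close>

definition boundary_kernel :: "real \<Rightarrow> real \<Rightarrow> real" where
  "boundary_kernel s x = 1 / (2 * sqrt pi) * x * heat_profile (3 / 2) (x\<^sup>2 / 4) s"

definition boundary_kernel_x :: "real \<Rightarrow> real \<Rightarrow> real" where
  "boundary_kernel_x s x = 1 / (2 * sqrt pi) *
     (heat_profile (3 / 2) (x\<^sup>2 / 4) s - x\<^sup>2 / 2 * heat_profile (5 / 2) (x\<^sup>2 / 4) s)"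

text \<open>Both the time derivative of \<open>boundary_kernel\<close> and its second space
  derivative; that they coincide is the heat equation for the kernel.\<close>

definition boundary_kernel_t :: "real \<Rightarrow> real \<Rightarrow> real" where
  "boundary_kernel_t s x = 1 / (2 * sqrt pi) * x *
     (x\<^sup>2 / 4 * heat_profile (7 / 2) (x\<^sup>2 / 4) s - 3 / 2 * heat_profile (5 / 2) (x\<^sup>2 / 4) s)"

lemmas boundary_kernel_defs = boundary_kernel_def boundary_kernel_x_def boundary_kernel_t_def

lemma boundary_kernel_nonpos [simp]: "s \<le> 0 \<Longrightarrow> boundary_kernel s x = 0"
  by (simp add: boundary_kernel_def)

lemma deriv_heat_kernel:
  assumes "s \<ge> 0"
  shows "deriv (heat_kernel s) x = - boundary_kernel s x / 2"
proof (cases "s = 0")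
  case True
  \<comment> \<open>Division by zero makes the heat kernel vanish at \<open>s = 0\<close>, in
    agreement with the profile, so the identity also covers the end point
    \<open>\<tau> = t\<close>.\<close>
  then have "heat_kernel s = (\<lambda>x. 0)"
    by (simp add: heat_kernel_def fun_eq_iff)
  then show ?thesis
    using True by simp
next
  case False
  with assms have s: "s > 0" by simp
  then have "s powr (3 / 2) = s * sqrt s"
    using powr_add [of s 1 "1 / 2"] by (simp add: powr_half_sqrt)
  then have "(heat_kernel s has_real_derivative - boundary_kernel s x / 2) (at x)"
    unfolding heat_kernel_def boundary_kernel_def using s
    by (auto intro!: derivative_eq_intros
        simp: heat_profile_def powr_minus real_sqrt_mult field_simps)
  then show ?thesis
    by (rule DERIV_imp_deriv)
qed

lemma DERIV_heat_profile_square: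
  "((\<lambda>x. heat_profile b (x\<^sup>2 / 4) s) has_real_derivative
     - heat_profile (b + 1) (x\<^sup>2 / 4) s * (x / 2)) (at x)"
  by (intro DERIV_chain2 [OF DERIV_heat_profile_space]) (auto intro!: derivative_eq_intros)

lemma DERIV_boundary_kernel:
  "(boundary_kernel s has_real_derivative boundary_kernel_x s x) (at x)"
  unfolding boundary_kernel_def [abs_def] boundary_kernel_x_def
  by (rule DERIV_cong [OF DERIV_mult [OF DERIV_cmult [OF DERIV_ident] DERIV_heat_profile_square]])
    (simp add: field_simps power2_eq_square)

lemma DERIV_boundary_kernel_x:
  "(boundary_kernel_x s has_real_derivative boundary_kernel_t s x) (at x)"
proof -
  have "((\<lambda>x. x\<^sup>2 / 2) has_real_derivative x) (at x)"
    by (auto intro!: derivative_eq_intros)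
  then show ?thesis
    unfolding boundary_kernel_x_def [abs_def] boundary_kernel_t_def
    by (intro DERIV_cong [OF DERIV_cmult [OF DERIV_diff [OF DERIV_heat_profile_square
          DERIV_mult [OF _ DERIV_heat_profile_square]]]])
      (auto simp: field_simps power2_eq_square)
qed

lemma DERIV_boundary_kernel_time:
  assumes "x > 0"
  shows "((\<lambda>s. boundary_kernel s x) has_real_derivative boundary_kernel_t s x) (at s)"
  unfolding boundary_kernel_def boundary_kernel_t_def
  using DERIV_cmult [OF DERIV_heat_profile_time [of "3 / 2" "x\<^sup>2 / 4" s], of "1 / (2 * sqrt pi) * x"] assms
  by (simp add: algebra_simps)

section \<open>Differentiating the potential under the integral\<close>

locale holder_boundary_data =
  fixes T \<beta> S H :: real and \<psi> :: "real \<Rightarrow> real"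
  assumes T_pos: "T > 0" and \<beta>: "0 < \<beta>" "\<beta> < 1 / 2"
    and bound: "\<And>t. t \<in> {0..T} \<Longrightarrow> \<bar>\<psi> t\<bar> \<le> S"
    and holder: "\<And>s t. s \<in> {0..T} \<Longrightarrow> t \<in> {0..T} \<Longrightarrow> \<bar>\<psi> s - \<psi> t\<bar> \<le> H * \<bar>s - t\<bar> powr \<beta>"
    and \<psi>_0: "\<psi> 0 = 0"
begin

lemma S_nonneg: "S \<ge> 0"
  using bound [of 0] T_pos by auto

lemma H_nonneg: "H \<ge> 0"
proof -
  have "0 \<le> H * T powr \<beta>"
    using holder [of T 0] T_pos by (auto intro: order_trans [OF abs_ge_zero])
  then show ?thesis
    using T_pos by (simp add: zero_le_mult_iff)
qed

lemma continuous_on_\<psi>: "continuous_on {0..T} \<psi>"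
  unfolding continuous_on_def
proof
  fix t assume t: "t \<in> {0..T}"
  have "((\<lambda>s. H * \<bar>s - t\<bar> powr \<beta>) \<longlongrightarrow> H * \<bar>t - t\<bar> powr \<beta>) (at t within {0..T})"
    using \<beta> by (intro tendsto_intros) auto
  then have "((\<lambda>s. H * \<bar>s - t\<bar> powr \<beta>) \<longlongrightarrow> 0) (at t within {0..T})"
    by simp
  moreover have "\<forall>\<^sub>F s in at t within {0..T}. norm (\<psi> s - \<psi> t) \<le> H * \<bar>s - t\<bar> powr \<beta>"
    using holder t by (auto simp: eventually_at_filter)
  ultimately have "((\<lambda>s. \<psi> s - \<psi> t) \<longlongrightarrow> 0) (at t within {0..T})"
    by (rule Lim_null_comparison [rotated])
  then show "(\<psi> \<longlongrightarrow> \<psi> t) (at t within {0..T})"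
    by (simp add: LIM_zero_iff)
qed

text \<open>The kernel is a parameter because each differentiation just replaces it by its
  derivative.\<close>

definition potential :: "(real \<Rightarrow> real \<Rightarrow> real) \<Rightarrow> real \<Rightarrow> real \<Rightarrow> real" where
  "potential k t x = integral {0..T} (\<lambda>\<tau>. k (t - \<tau>) x * \<psi> \<tau>)"

text \<open>Here \<open>f\<close> is the time lag, \<open>g\<close> the position and
  \<open>h\<close> the source time. The general form serves integrability, the Leibniz rule and
  continuity of parameter integrals alike.\<close>

lemma continuous_on_kernel_times_\<psi>:
  assumes "k \<in> {boundary_kernel, boundary_kernel_x, boundary_kernel_t}"
    "continuous_on A f" "continuous_on A g" "continuous_on A h"
    "\<And>p. p \<in> A \<Longrightarrow> g p > 0" "h ` A \<subseteq> {0..T}"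
  shows "continuous_on A (\<lambda>p. k (f p) (g p) * \<psi> (h p))"
proof -
  have "continuous_on A (\<lambda>p. k (f p) (g p))"
    using assms(1) unfolding boundary_kernel_defs [abs_def]
    by (auto intro!: continuous_intros assms dest: assms(5))
  then show ?thesis
    using continuous_on_\<psi> assms by (intro continuous_intros continuous_on_compose2 [of _ \<psi> _ h])
qed

text \<open>The Leibniz rule on the fixed interval \<open>{0..T}\<close>. The second and third
  claims share their right-hand side, which is the heat equation. In time the parameter set is all
  of \<open>UNIV\<close>, since the profiles are smooth across zero lag.\<close>

lemma DERIV_potential:
  assumes "x > 0"
  shows "(potential boundary_kernel t has_real_derivative potential boundary_kernel_x t x) (at x)"
    and "(potential boundary_kernel_x t has_real_derivative potential boundary_kernel_t t x) (at x)"
    and "((\<lambda>t. potential boundary_kernel t x) has_real_derivative potential boundary_kernel_t t x) (at t)"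
proof -
  have at: "at x within {0<..} = at x"
    using assms by (simp add: at_within_open [of _ "{0<..}"])
  have c: "continuous_on ({0<..} \<times> {0..T}) (\<lambda>(x, \<tau>). k (t - \<tau>) x * \<psi> \<tau>)"
    "continuous_on (UNIV \<times> {0..T}) (\<lambda>(t, \<tau>). k (t - \<tau>) x * \<psi> \<tau>)"
    if "k \<in> {boundary_kernel, boundary_kernel_x, boundary_kernel_t}" for k
    unfolding split_beta
    by (rule continuous_on_kernel_times_\<psi> [OF that]; use assms in \<open>force intro!: continuous_intros\<close>)+
  have i: "(\<lambda>\<tau>. k (t - \<tau>) y * \<psi> \<tau>) integrable_on {0..T}"
    if "k \<in> {boundary_kernel, boundary_kernel_x, boundary_kernel_t}" "y > 0" for k t y
    by (intro integrable_continuous_interval continuous_on_kernel_times_\<psi> [OF that(1)])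
      (use that(2) in \<open>auto intro!: continuous_intros\<close>)
  show "(potential boundary_kernel t has_real_derivative potential boundary_kernel_x t x) (at x)"
    using leibniz_rule_field_derivative [of "{0<..}" 0 T "\<lambda>x \<tau>. boundary_kernel (t - \<tau>) x * \<psi> \<tau>"
        "\<lambda>x \<tau>. boundary_kernel_x (t - \<tau>) x * \<psi> \<tau>" x] assms
    by (simp add: potential_def [abs_def] at c i DERIV_cmult_right has_field_derivative_at_within
        DERIV_boundary_kernel)
  show "(potential boundary_kernel_x t has_real_derivative potential boundary_kernel_t t x) (at x)"
    using leibniz_rule_field_derivative [of "{0<..}" 0 T "\<lambda>x \<tau>. boundary_kernel_x (t - \<tau>) x * \<psi> \<tau>"
        "\<lambda>x \<tau>. boundary_kernel_t (t - \<tau>) x * \<psi> \<tau>" x] assms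
    by (simp add: potential_def [abs_def] at c i DERIV_cmult_right has_field_derivative_at_within
        DERIV_boundary_kernel_x)
  have D: "((\<lambda>t. boundary_kernel (t - \<tau>) x * \<psi> \<tau>) has_real_derivative
      boundary_kernel_t (t - \<tau>) x * \<psi> \<tau>) (at t)" for t \<tau>
    by (intro DERIV_cmult_right DERIV_chain2 [OF DERIV_boundary_kernel_time [OF assms], THEN DERIV_cong])
      (auto intro!: derivative_eq_intros)
  show "((\<lambda>t. potential boundary_kernel t x) has_real_derivative potential boundary_kernel_t t x) (at t)"
    using leibniz_rule_field_derivative [of UNIV 0 T "\<lambda>t \<tau>. boundary_kernel (t - \<tau>) x * \<psi> \<tau>"
        "\<lambda>t \<tau>. boundary_kernel_t (t - \<tau>) x * \<psi> \<tau>" t] assms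
    by (simp add: potential_def [abs_def] c i D)
qed

lemma continuous_on_potential:
  assumes "k \<in> {boundary_kernel, boundary_kernel_x, boundary_kernel_t}"
  shows "continuous_on (UNIV \<times> {0<..}) (\<lambda>(t, x). potential k t x)"
proof -
  have "continuous_on ((UNIV \<times> {0<..}) \<times> {0..T}) (\<lambda>q. k (fst (fst q) - snd q) (snd (fst q)) * \<psi> (snd q))"
    by (rule continuous_on_kernel_times_\<psi> [OF assms]) (force intro!: continuous_intros)+
  then show ?thesis
    using integral_continuous_on_param
      [of "UNIV \<times> {0<..}" 0 T "\<lambda>(t, x) \<tau>. k (t - \<tau>) x * \<psi> \<tau>"]
    by (simp add: potential_def split_beta)
qed

lemma heat_boundary_potential_eq:
  assumes "t \<in> {0..T}" "x > 0"
  shows "heat_boundary_potential \<psi> t x = potential boundary_kernel t x"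
proof -
  have "heat_boundary_potential \<psi> t x = (LBINT \<tau>:{0..t}. boundary_kernel (t - \<tau>) x * \<psi> \<tau>)"
  proof -
    have "heat_boundary_potential \<psi> t x =
        (-2) * (LBINT \<tau>:{0..t}. (- 1 / 2) * (boundary_kernel (t - \<tau>) x * \<psi> \<tau>))"
      unfolding heat_boundary_potential_def
      by (intro arg_cong2 [where f = "(*)"] set_lebesgue_integral_cong) (auto simp: deriv_heat_kernel)
    then show ?thesis
      unfolding set_integral_mult_right by simp
  qed
  \<comment> \<open>Between \<open>t\<close> and \<open>T\<close> the lag is negative and the kernel
    vanishes.\<close>
  also have "\<dots> = (LBINT \<tau>:{0..T}. boundary_kernel (t - \<tau>) x * \<psi> \<tau>)"
    unfolding set_lebesgue_integral_def
    by (intro Bochner_Integration.integral_cong) (use assms in \<open>auto simp: indicator_def\<close>)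
  also have "\<dots> = potential boundary_kernel t x"
    unfolding potential_def using assms
    by (intro set_borel_integral_eq_integral(2) borel_integrable_atLeastAtMost'
        continuous_on_kernel_times_\<psi> continuous_intros) auto
  finally show ?thesis .
qed

section \<open>Rescaling the potentials to integrals over the whole line\<close>

definition data :: "real \<Rightarrow> real" where
  "data r = indicator {0..T} r * \<psi> r"

lemma borel_measurable_data [measurable]: "data \<in> borel_measurable borel"
  using borel_measurable_continuous_on_indicator [OF _ continuous_on_\<psi>]
  by (simp add: data_def [abs_def])

lemma abs_data_le: "\<bar>data r\<bar> \<le> S"
  using bound S_nonneg by (auto simp: data_def indicator_def)

text \<open>With \<open>a = x\<^sup>2 / 4\<close>, this is what the substitution \<open>\<tau> = t - a * z\<close> makes of the potentials.\<close>

definition scaled_integral :: "real \<Rightarrow> real \<Rightarrow> real \<Rightarrow> real" where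
  "scaled_integral b t a = (LBINT z. heat_profile b 1 z * data (t - a * z))"

lemma integrable_scaled:
  assumes "b > 1"
  shows "integrable lborel (\<lambda>z. heat_profile b 1 z * data (t - a * z))"
proof (rule Bochner_Integration.integrable_bound)
  show "integrable lborel (\<lambda>z. heat_profile b 1 z * S)"
    using has_bochner_integral_heat_profile [OF assms] by (auto simp: has_bochner_integral_iff)
  show "AE z in lborel. norm (heat_profile b 1 z * data (t - a * z)) \<le> norm (heat_profile b 1 z * S)"
    using abs_data_le S_nonneg by (auto simp: abs_mult intro!: mult_left_mono)
qed measurable

lemma heat_profile_data_scale:
  assumes "b > 1" "a > 0"
  shows "integrable lborel (\<lambda>\<tau>. heat_profile b a (t - \<tau>) * data \<tau>)"
    and "(LBINT \<tau>. heat_profile b a (t - \<tau>) * data \<tau>) = a powr (1 - b) * scaled_integral b t a"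
proof -
  let ?f = "\<lambda>\<tau>. heat_profile b a (t - \<tau>) * data \<tau>"
  \<comment> \<open>The substitution \<open>\<tau> = t - a * z\<close> normalises the profile to
    parameter 1; together with the Jacobian \<open>a\<close> it yields the factor
    \<open>a powr (1 - b)\<close>.\<close>
  have *: "?f (t + - a * z) = a powr (- b) * (heat_profile b 1 z * data (t - a * z))" for z
    using assms by (simp add: heat_profile_scale [of a b "a * z"])
  have "integrable lborel (\<lambda>z. ?f (t + - a * z))"
    unfolding * using integrable_scaled [OF assms(1)] by simp
  then show "integrable lborel ?f"
    using lborel_integrable_real_affine_iff [of "- a" ?f t] assms by auto
  have "(LBINT \<tau>. ?f \<tau>) = \<bar>- a\<bar> *\<^sub>R (LBINT z. ?f (t + - a * z))"
    using assms by (intro lborel_integral_real_affine) auto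
  also have "\<dots> = a * a powr (- b) * scaled_integral b t a"
    unfolding * scaled_integral_def using assms by simp
  also have "a * a powr (- b) = a powr (1 - b)"
    using assms by (simp add: powr_diff powr_minus field_simps)
  finally show "(LBINT \<tau>. ?f \<tau>) = a powr (1 - b) * scaled_integral b t a" .
qed

lemma potential_eq_LBINT:
  assumes "k \<in> {boundary_kernel, boundary_kernel_x, boundary_kernel_t}" "x > 0"
  shows "potential k t x = (LBINT \<tau>. k (t - \<tau>) x * data \<tau>)"
proof -
  have "potential k t x = (LBINT \<tau>:{0..T}. k (t - \<tau>) x * \<psi> \<tau>)"
    unfolding potential_def using assms
    by (intro set_borel_integral_eq_integral(2) [symmetric] borel_integrable_atLeastAtMost'
        continuous_on_kernel_times_\<psi> continuous_intros) auto
  then show ?thesis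
    by (simp add: set_lebesgue_integral_def data_def mult_ac)
qed

text \<open>For \<open>a = x\<^sup>2 / 4\<close> the scaling factors are \<open>2 / x\<close> and
  \<open>8 / x ^ 3\<close>. They cancel the factor \<open>x\<close> of the kernel and leave
  \<open>1 / x\<close> in front of its derivative.\<close>

lemma potential_eq_scaled_integral:
  assumes "x > 0"
  shows "potential boundary_kernel t x = scaled_integral (3 / 2) t (x\<^sup>2 / 4) / sqrt pi"
    and "potential boundary_kernel_x t x =
      (scaled_integral (3 / 2) t (x\<^sup>2 / 4) - 2 * scaled_integral (5 / 2) t (x\<^sup>2 / 4)) / (sqrt pi * x)"
proof -
  let ?a = "x\<^sup>2 / 4"
  have a: "?a > 0" using assms by simp
  have half: "?a powr (1 / 2) = x / 2"
    using assms by (simp add: powr_half_sqrt real_sqrt_divide)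
  have p1: "?a powr (1 - 3 / 2) = 2 / x"
  proof -
    have "?a powr (1 - 3 / 2) = inverse (?a powr (1 / 2))"
      using powr_minus [of ?a "1 / 2"] by simp
    then show ?thesis
      unfolding half by simp
  qed
  have p2: "?a powr (1 - 5 / 2) = 8 / x ^ 3"
  proof -
    have "?a powr (1 - 5 / 2) = ?a powr (1 - 3 / 2) / ?a powr 1"
      unfolding powr_diff [symmetric] by simp
    then show ?thesis
      unfolding p1 using assms by (simp add: power2_eq_square power3_eq_cube)
  qed
  note I = heat_profile_data_scale [OF _ a, of "3 / 2" t, unfolded p1]
    heat_profile_data_scale [OF _ a, of "5 / 2" t, unfolded p2]
  have "potential boundary_kernel t x =
      (LBINT \<tau>. 1 / (2 * sqrt pi) * x * (heat_profile (3 / 2) ?a (t - \<tau>) * data \<tau>))"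
    using assms by (simp add: potential_eq_LBINT boundary_kernel_def mult.assoc)
  also have "\<dots> = scaled_integral (3 / 2) t ?a / sqrt pi"
    using assms I by (simp add: integral_mult_right_zero field_simps)
  finally show "potential boundary_kernel t x = scaled_integral (3 / 2) t ?a / sqrt pi" .
  have "potential boundary_kernel_x t x = (LBINT \<tau>. 1 / (2 * sqrt pi) *
      ((heat_profile (3 / 2) ?a (t - \<tau>) * data \<tau>) - x\<^sup>2 / 2 * (heat_profile (5 / 2) ?a (t - \<tau>) * data \<tau>)))"
    using assms by (simp add: potential_eq_LBINT boundary_kernel_x_def algebra_simps)
  also have "\<dots> = 1 / (2 * sqrt pi) *
      (2 / x * scaled_integral (3 / 2) t ?a - x\<^sup>2 / 2 * (8 / x ^ 3 * scaled_integral (5 / 2) t ?a))"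
    using I by (simp add: Bochner_Integration.integral_diff)
  also have "\<dots> = (scaled_integral (3 / 2) t ?a - 2 * scaled_integral (5 / 2) t ?a) / (sqrt pi * x)"
    using assms by (simp add: power2_eq_square power3_eq_cube field_simps)
  finally show "potential boundary_kernel_x t x =
    (scaled_integral (3 / 2) t ?a - 2 * scaled_integral (5 / 2) t ?a) / (sqrt pi * x)" .
qed

section \<open>Pointwise bounds for the potential and its space derivative\<close>

lemma abs_scaled_integral_le:
  assumes "b > 1"
  shows "\<bar>scaled_integral b t a\<bar> \<le> S * Gamma (b - 1)"
proof -
  note G = has_bochner_integral_heat_profile [OF assms]
  have "\<bar>scaled_integral b t a\<bar> \<le> (LBINT z. heat_profile b 1 z * S)"
    unfolding scaled_integral_def
    using G abs_data_le S_nonneg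
    by (intro order_trans [OF integral_abs_bound] integral_mono integrable_abs integrable_scaled assms)
     (auto simp: has_bochner_integral_iff abs_mult intro!: mult_left_mono)
  also have "\<dots> = S * Gamma (b - 1)"
    using G by (simp add: has_bochner_integral_iff)
  finally show ?thesis .
qed

text \<open>Here the profile is bounded by its maximum rather than by its mass. In the unscaled
  integral the data live on an interval of length \<open>T\<close>, and the missing power of
  \<open>a\<close> becomes the decay \<open>1 / a\<close>.\<close>

lemma scaled_integral_decay:
  assumes "b > 1" "a > 0"
  shows "\<bar>scaled_integral b t a\<bar> \<le> S * b powr b * T / a"
proof -
  have data: "integrable lborel (\<lambda>\<tau>. b powr b * (S * indicator {0..T} \<tau>))"
    "(LBINT \<tau>. a powr (- b) * (b powr b * (S * indicator {0..T} \<tau>))) = a powr (- b) * (b powr b * (S * T))"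
    using T_pos by auto
  have "heat_profile b a s \<le> a powr (- b) * b powr b" for s
    unfolding heat_profile_scale [OF assms(2), of b s]
    using heat_profile_le [of b "s / a"] assms by (intro mult_left_mono) auto
  moreover have "\<bar>data \<tau>\<bar> \<le> S * indicator {0..T} \<tau>" for \<tau>
    using bound by (auto simp: data_def indicator_def)
  ultimately have le: "\<bar>heat_profile b a (t - \<tau>) * data \<tau>\<bar>
      \<le> a powr (- b) * b powr b * (S * indicator {0..T} \<tau>)" for \<tau>
    unfolding abs_mult by (intro mult_mono) auto
  have "a powr (1 - b) * \<bar>scaled_integral b t a\<bar> = \<bar>LBINT \<tau>. heat_profile b a (t - \<tau>) * data \<tau>\<bar>"
    using heat_profile_data_scale [OF assms] by (simp add: abs_mult)
  also have "\<dots> \<le> (LBINT \<tau>. a powr (- b) * (b powr b * (S * indicator {0..T} \<tau>)))"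
    using le
    by (intro order_trans [OF integral_abs_bound] integral_mono integrable_abs integrable_mult_right data
        heat_profile_data_scale assms) (simp_all add: mult.assoc)
  also have "\<dots> = a powr (1 - b) * (S * b powr b * T / a)"
    unfolding data using assms by (simp add: powr_diff powr_minus field_simps)
  finally show ?thesis
    by (rule mult_left_le_imp_le) (use assms in simp)
qed

text \<open>Replacing the data by \<open>\<psi> t\<close> costs at most
  \<open>H * (a * z) powr \<beta>\<close>. The factor \<open>z powr \<beta>\<close> lowers the
  exponent of the profile to \<open>b - \<beta>\<close>, still above 1, so the error is again a
  Gamma value.\<close>

lemma scaled_integral_near_boundary:
  assumes b: "b > 1 + \<beta>" and a: "a > 0" and t: "t \<in> {0..T}"
  shows "\<bar>scaled_integral b t a - \<psi> t * Gamma (b - 1)\<bar> \<le> H * a powr \<beta> * Gamma (b - 1 - \<beta>)"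
proof -
  have b1: "b > 1" "b - \<beta> > 1" using b \<beta> by auto
  note G = has_bochner_integral_heat_profile [OF b1(1)] has_bochner_integral_heat_profile [OF b1(2)]
  have data: "\<bar>data (t - s) - \<psi> t\<bar> \<le> H * s powr \<beta>" if s: "s > 0" for s
  proof (cases "t - s \<ge> 0")
    case True
    then show ?thesis
      using holder [of "t - s" t] t s by (simp add: data_def)
  next
    case False
    \<comment> \<open>At negative times the data vanish; \<open>\<psi> 0 = 0\<close> gives
      \<open>\<bar>\<psi> t\<bar> \<le> H * t powr \<beta>\<close>, and
      \<open>t < s\<close>.\<close>
    then have "data (t - s) = 0" by (simp add: data_def)
    moreover have "\<bar>\<psi> t\<bar> \<le> H * t powr \<beta>"
      using holder [of t 0] t \<psi>_0 T_pos by simp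
    moreover have "H * t powr \<beta> \<le> H * s powr \<beta>"
      using False t \<beta> H_nonneg by (intro mult_left_mono powr_mono2) auto
    ultimately show ?thesis by simp
  qed
  have le: "\<bar>heat_profile b 1 z * data (t - a * z) - \<psi> t * heat_profile b 1 z\<bar>
      \<le> H * a powr \<beta> * heat_profile (b - \<beta>) 1 z" for z
  proof (cases "z > 0")
    case True
    have "\<bar>heat_profile b 1 z * data (t - a * z) - \<psi> t * heat_profile b 1 z\<bar>
        = heat_profile b 1 z * \<bar>data (t - a * z) - \<psi> t\<bar>"
      by (simp add: abs_mult_pos' algebra_simps flip: right_diff_distrib)
    also have "\<dots> \<le> heat_profile b 1 z * (H * (a * z) powr \<beta>)"
      using data [of "a * z"] True a by (intro mult_left_mono) auto
    also have "\<dots> = H * a powr \<beta> * (z powr \<beta> * heat_profile b 1 z)"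
      using True a by (simp add: powr_mult)
    finally show ?thesis
      by (simp add: heat_profile_shift)
  qed simp
  have int: "integrable lborel (\<lambda>z. heat_profile b 1 z * data (t - a * z) - \<psi> t * heat_profile b 1 z)"
    using integrable_scaled [OF b1(1)] G by (auto simp: has_bochner_integral_iff)
  have "scaled_integral b t a - \<psi> t * Gamma (b - 1) =
      (LBINT z. heat_profile b 1 z * data (t - a * z) - \<psi> t * heat_profile b 1 z)"
    using integrable_scaled [OF b1(1)] G
    by (simp add: scaled_integral_def has_bochner_integral_iff)
  also have "\<bar>\<dots>\<bar> \<le> (LBINT z. H * a powr \<beta> * heat_profile (b - \<beta>) 1 z)"
    using int le G
    by (intro order_trans [OF integral_abs_bound] integral_mono integrable_abs)
      (auto simp: has_bochner_integral_iff)
  also have "\<dots> = H * a powr \<beta> * Gamma (b - 1 - \<beta>)"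
    using G by (simp add: has_bochner_integral_iff algebra_simps)
  finally show ?thesis .
qed

text \<open>\<open>Gamma (1 / 2) = sqrt pi\<close> means that the kernel has mass one. The error is
  uniform in \<open>t\<close> and vanishes with \<open>x\<close>, so the boundary values are
  attained.\<close>

lemma potential_near_boundary:
  assumes "t \<in> {0..T}" "x > 0"
  shows "\<bar>potential boundary_kernel t x - \<psi> t\<bar> \<le> H * (x\<^sup>2 / 4) powr \<beta> * Gamma (1 / 2 - \<beta>) / sqrt pi"
proof -
  have "potential boundary_kernel t x - \<psi> t
      = (scaled_integral (3 / 2) t (x\<^sup>2 / 4) - \<psi> t * Gamma (3 / 2 - 1)) / sqrt pi"
    using assms by (simp add: potential_eq_scaled_integral Gamma_one_half_real diff_divide_distrib)
  also have "\<bar>\<dots>\<bar> \<le> H * (x\<^sup>2 / 4) powr \<beta> * Gamma (3 / 2 - 1 - \<beta>) / sqrt pi"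
    using scaled_integral_near_boundary [of "3 / 2" "x\<^sup>2 / 4" t] assms \<beta>
    by (simp add: divide_right_mono)
  finally show ?thesis
    by simp
qed

text \<open>Since \<open>2 * Gamma (3 / 2) = Gamma (1 / 2)\<close>, the contributions of the constant \<open>\<psi> t\<close> cancel.\<close>

lemma potential_x_near_boundary:
  assumes "t \<in> {0..T}" "x > 0"
  shows "\<bar>potential boundary_kernel_x t x\<bar>
    \<le> H * (Gamma (1 / 2 - \<beta>) + 2 * Gamma (3 / 2 - \<beta>)) * x powr (2 * \<beta> - 1)"
proof -
  let ?a = "x\<^sup>2 / 4"
  define G where "G = Gamma (1 / 2 - \<beta>) + 2 * Gamma (3 / 2 - \<beta>)"
  have "Gamma (1 / 2 - \<beta>) > 0" "Gamma (3 / 2 - \<beta>) > 0"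
    using \<beta> by (auto intro!: Gamma_real_pos)
  then have "G \<ge> 0"
    by (simp add: G_def)
  have "Gamma (3 / 2 :: real) = Gamma (1 / 2) / 2"
    using Gamma_plus1 [of "1 / 2 :: real"] nonpos_Ints_nonpos [of "1 / 2 :: real"] by auto
  then have eq: "scaled_integral (3 / 2) t ?a - 2 * scaled_integral (5 / 2) t ?a =
      (scaled_integral (3 / 2) t ?a - \<psi> t * Gamma (3 / 2 - 1))
      - 2 * (scaled_integral (5 / 2) t ?a - \<psi> t * Gamma (5 / 2 - 1))"
    by (simp add: algebra_simps)
  have "\<bar>scaled_integral (3 / 2) t ?a - 2 * scaled_integral (5 / 2) t ?a\<bar>
      \<le> H * ?a powr \<beta> * Gamma (3 / 2 - 1 - \<beta>) + 2 * (H * ?a powr \<beta> * Gamma (5 / 2 - 1 - \<beta>))"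
  proof -
    have triangle: "\<bar>y - 2 * z\<bar> \<le> Y + 2 * Z" if "\<bar>y\<bar> \<le> Y" "\<bar>z\<bar> \<le> Z" for y z Y Z :: real
      using that by linarith
    show ?thesis
      unfolding eq
      by (intro triangle scaled_integral_near_boundary) (use assms \<beta> in auto)
  qed
  also have "\<dots> = H * G * ?a powr \<beta>"
    by (simp add: G_def algebra_simps)
  also have "\<dots> \<le> H * G * x powr (2 * \<beta>)"
  proof -
    \<comment> \<open>The factor \<open>4 powr - \<beta>\<close>, at most 1, is dropped.\<close>
    have "?a powr \<beta> \<le> (x powr 2) powr \<beta>"
      using assms \<beta> by (intro powr_mono2) auto
    then show ?thesis
      using H_nonneg \<open>G \<ge> 0\<close> by (intro mult_left_mono) (auto simp: powr_powr)
  qed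
  finally have *: "\<bar>scaled_integral (3 / 2) t ?a - 2 * scaled_integral (5 / 2) t ?a\<bar> \<le> H * G * x powr (2 * \<beta>)" .
  have "\<bar>potential boundary_kernel_x t x\<bar>
      = \<bar>scaled_integral (3 / 2) t ?a - 2 * scaled_integral (5 / 2) t ?a\<bar> / (sqrt pi * x)"
    using assms by (simp add: potential_eq_scaled_integral abs_mult)
  also have "\<dots> \<le> H * G * x powr (2 * \<beta>) / (1 * x)"
  proof (intro frac_le * mult_right_mono)
    show "1 \<le> sqrt pi"
      using pi_gt3 by (simp add: real_le_rsqrt)
  qed (use assms H_nonneg \<open>G \<ge> 0\<close> in auto)
  also have "\<dots> = H * G * x powr (2 * \<beta> - 1)"
    using assms by (simp add: powr_diff)
  finally show ?thesis
    unfolding G_def .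
qed

text \<open>A maximum principle: the kernel is nonnegative with mass one, so no constant
  enters.\<close>

lemma abs_potential_le:
  assumes "t \<in> {0..T}" "x > 0"
  shows "\<bar>potential boundary_kernel t x\<bar> \<le> S"
  using abs_scaled_integral_le [of "3 / 2" t "x\<^sup>2 / 4"] assms
  by (simp add: potential_eq_scaled_integral Gamma_one_half_real divide_le_eq)

lemma potential_decay:
  assumes "t \<in> {0..T}" "x \<ge> 1"
  defines "B \<equiv> (3 / 2) powr (3 / 2) + 2 * (5 / 2) powr (5 / 2 :: real)"
  shows "\<bar>potential boundary_kernel t x\<bar> \<le> 4 * S * B * T * x powr (- 2)"
    and "\<bar>potential boundary_kernel_x t x\<bar> \<le> 4 * S * B * T * x powr (- 2)"
proof -
  let ?a = "x\<^sup>2 / 4"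
  have x: "x > 0" and a: "?a > 0" using assms(2) by auto
  have pi: "1 \<le> sqrt pi"
    using pi_gt3 by (simp add: real_le_rsqrt)
  have xp: "x powr (- 2) = 1 / x\<^sup>2"
    using x by (simp add: powr_minus_divide)
  have nn: "0 \<le> S * T / ?a"
    using S_nonneg T_pos by simp
  have I: "\<bar>scaled_integral (3 / 2) t ?a\<bar> \<le> (3 / 2) powr (3 / 2) * (S * T / ?a)"
    "\<bar>scaled_integral (5 / 2) t ?a\<bar> \<le> (5 / 2) powr (5 / 2) * (S * T / ?a)"
    using scaled_integral_decay [OF _ a, of "3 / 2" t] scaled_integral_decay [OF _ a, of "5 / 2" t]
    by (simp_all add: mult_ac)
  have "\<bar>scaled_integral (3 / 2) t ?a - 2 * scaled_integral (5 / 2) t ?a\<bar>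
      \<le> \<bar>scaled_integral (3 / 2) t ?a\<bar> + 2 * \<bar>scaled_integral (5 / 2) t ?a\<bar>"
    by linarith
  also have "\<dots> \<le> B * (S * T / ?a)"
    unfolding B_def distrib_right using I by linarith
  finally have J: "\<bar>scaled_integral (3 / 2) t ?a - 2 * scaled_integral (5 / 2) t ?a\<bar> \<le> B * (S * T / ?a)" .
  have "0 \<le> (5 / 2) powr (5 / 2) * (S * T / ?a)"
    by (rule mult_nonneg_nonneg [OF _ nn]) simp
  with I(1) have J': "\<bar>scaled_integral (3 / 2) t ?a\<bar> \<le> B * (S * T / ?a)"
    unfolding B_def distrib_right by linarith
  have "B \<ge> 0"
    by (simp add: B_def)
  then have BST: "B * (S * T / ?a) \<ge> 0"
    using nn by (rule mult_nonneg_nonneg)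
  have eq: "B * (S * T / ?a) = 4 * S * B * T * x powr (- 2)"
    using xp by simp
  have "\<bar>potential boundary_kernel t x\<bar> = \<bar>scaled_integral (3 / 2) t ?a\<bar> / sqrt pi"
    using x by (simp add: potential_eq_scaled_integral)
  also have "\<dots> \<le> B * (S * T / ?a) / 1"
    using J' pi BST by (intro frac_le) auto
  finally show "\<bar>potential boundary_kernel t x\<bar> \<le> 4 * S * B * T * x powr (- 2)"
    using eq by simp
  have "1 * 1 \<le> sqrt pi * x"
    using pi assms(2) by (intro mult_mono) auto
  have "\<bar>potential boundary_kernel_x t x\<bar>
      = \<bar>scaled_integral (3 / 2) t ?a - 2 * scaled_integral (5 / 2) t ?a\<bar> / (sqrt pi * x)"
    using x by (simp add: potential_eq_scaled_integral abs_mult)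
  also have "\<dots> \<le> B * (S * T / ?a) / 1"
    using J \<open>1 * 1 \<le> sqrt pi * x\<close> BST by (intro frac_le) auto
  finally show "\<bar>potential boundary_kernel_x t x\<bar> \<le> 4 * S * B * T * x powr (- 2)"
    using eq by simp
qed

section \<open>The potential as a classical solution\<close>

lemma DERIV_heat_boundary_potential:
  assumes t: "t \<in> {0..T}" and x: "x > 0"
  shows "(heat_boundary_potential \<psi> t has_real_derivative potential boundary_kernel_x t x) (at x)"
    and "(deriv (heat_boundary_potential \<psi> t) has_real_derivative potential boundary_kernel_t t x) (at x)"
    and "((\<lambda>s. heat_boundary_potential \<psi> s x) has_real_derivative potential boundary_kernel_t t x)
           (at t within {0..T})"
proof -
  have D: "(heat_boundary_potential \<psi> t has_real_derivative potential boundary_kernel_x t x) (at x)"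
    if x: "x > 0" for x
    by (rule has_field_derivative_transform_within_open [OF DERIV_potential(1) [OF x], of "{0<..}"])
      (use x t in \<open>auto simp: heat_boundary_potential_eq\<close>)
  show "(heat_boundary_potential \<psi> t has_real_derivative potential boundary_kernel_x t x) (at x)"
    using D [OF x] .
  show "(deriv (heat_boundary_potential \<psi> t) has_real_derivative potential boundary_kernel_t t x) (at x)"
    by (rule has_field_derivative_transform_within_open [OF DERIV_potential(2) [OF x], of "{0<..}"])
      (use x DERIV_imp_deriv [OF D] in auto)
  \<comment> \<open>The two functions are identified only for times in \<open>{0..T}\<close>, so the
    two-sided derivative of \<open>potential\<close> yields a derivative within that
    interval.\<close>
  show "((\<lambda>s. heat_boundary_potential \<psi> s x) has_real_derivative potential boundary_kernel_t t x)
           (at t within {0..T})"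
    by (rule has_field_derivative_transform_within
          [OF has_field_derivative_at_within [OF DERIV_potential(3) [OF x]], of 1])
      (use x t in \<open>auto simp: heat_boundary_potential_eq\<close>)
qed

text \<open>For \<open>x > 0\<close> this is continuity of a parameter integral. At
  \<open>x = 0\<close> the error bound near the boundary, uniform in time, squeezes the function
  towards the continuous \<open>\<psi>\<close>; the corner at time 0 needs no separate
  treatment.\<close>

lemma continuous_on_heat_boundary_potential:
  "continuous_on ({0..T} \<times> {0..}) (\<lambda>(t, x). if x = 0 then \<psi> t else heat_boundary_potential \<psi> t x)"
  (is "continuous_on ?S ?F")
  unfolding continuous_on_def
proof
  fix p assume p: "p \<in> ?S"
  show "(?F \<longlongrightarrow> ?F p) (at p within ?S)"
  proof (cases "snd p = 0")
    case False
    let ?P = "\<lambda>(t, x). potential boundary_kernel t x"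
    have in_S: "\<forall>\<^sub>F q in at p within ?S. q \<in> ?S"
      by (simp add: eventually_at_filter)
    have "(snd \<longlongrightarrow> snd p) (at p within ?S)"
      by (intro tendsto_intros)
    then have "\<forall>\<^sub>F q in at p within ?S. snd q > 0"
      by (rule order_tendstoD) (use False p in auto)
    with in_S have ev: "\<forall>\<^sub>F q in at p within ?S. ?P q = ?F q"
      by eventually_elim (auto simp: heat_boundary_potential_eq)
    have "open (UNIV \<times> {0<..} :: (real \<times> real) set)"
      by (intro open_Times) auto
    moreover have "p \<in> UNIV \<times> {0<..}"
      using False p by auto
    ultimately have "isCont ?P p"
      using continuous_on_potential [of boundary_kernel]
      by (auto simp: continuous_on_eq_continuous_at)
    then have "(?P \<longlongrightarrow> ?P p) (at p within ?S)"
      using continuous_at_imp_continuous_at_within continuous_within by blast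
    then have "(?F \<longlongrightarrow> ?P p) (at p within ?S)"
      using ev by (rule Lim_transform_eventually)
    moreover have "?P p = ?F p"
      using False p by (auto simp: heat_boundary_potential_eq split_beta)
    ultimately show ?thesis
      by (simp only:)
  next
    case True
    let ?h = "\<lambda>q::real \<times> real. H * ((snd q)\<^sup>2 / 4) powr \<beta> * Gamma (1 / 2 - \<beta>) / sqrt pi"
    have "(?h \<longlongrightarrow> H * ((snd p)\<^sup>2 / 4) powr \<beta> * Gamma (1 / 2 - \<beta>) / sqrt pi) (at p within ?S)"
      using \<beta> by (intro tendsto_intros) auto
    then have h: "(?h \<longlongrightarrow> 0) (at p within ?S)"
      using True by simp
    have "norm (?F q - \<psi> (fst q)) \<le> ?h q" if "q \<in> ?S" for q
      using that potential_near_boundary [of "fst q" "snd q"] \<beta>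
      by (cases "snd q = 0") (auto simp: split_beta heat_boundary_potential_eq)
    then have "\<forall>\<^sub>F q in at p within ?S. norm (?F q - \<psi> (fst q)) \<le> ?h q"
      by (auto simp: eventually_at_filter)
    then have "((\<lambda>q. ?F q - \<psi> (fst q)) \<longlongrightarrow> 0) (at p within ?S)"
      using h by (rule Lim_null_comparison)
    moreover have "continuous_on ?S (\<lambda>q. \<psi> (fst q))"
      by (rule continuous_on_compose2 [OF continuous_on_\<psi>]) (auto intro: continuous_intros)
    then have "((\<lambda>q. \<psi> (fst q)) \<longlongrightarrow> \<psi> (fst p)) (at p within ?S)"
      using p unfolding continuous_on_def by blast
    ultimately have "((\<lambda>q. (?F q - \<psi> (fst q)) + \<psi> (fst q)) \<longlongrightarrow> 0 + \<psi> (fst p)) (at p within ?S)"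
      by (rule tendsto_add)
    then have "(?F \<longlongrightarrow> \<psi> (fst p)) (at p within ?S)"
      by (simp only: diff_add_cancel add_0)
    moreover have "?F p = \<psi> (fst p)"
      using True by (simp add: split_beta)
    ultimately show ?thesis
      by (simp only:)
  qed
qed

lemma solves_half_line_heat_problem:
  "solves_half_line_heat_problem T \<psi> (heat_boundary_potential \<psi>)"
proof -
  have "heat_boundary_potential \<psi> 0 x = 0" if "x > 0" for x
  proof -
    \<comment> \<open>At time 0 every lag \<open>- \<tau>\<close> is nonpositive, where the kernel
      vanishes.\<close>
    have "potential boundary_kernel 0 x = integral {0..T} (\<lambda>\<tau>. 0)"
      unfolding potential_def by (intro Henstock_Kurzweil_Integration.integral_cong) simp
    then show ?thesis
      using that T_pos by (simp add: heat_boundary_potential_eq)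
  qed
  moreover have "heat_boundary_potential \<psi> t differentiable at x \<and>
      (\<exists>D. ((\<lambda>s. heat_boundary_potential \<psi> s x) has_real_derivative D) (at t within {0..T}) \<and>
        (deriv (heat_boundary_potential \<psi> t) has_real_derivative D) (at x))"
    if "t \<in> {0<..T}" "x > 0" for t x
    using DERIV_heat_boundary_potential [of t x] that real_differentiable_def by auto
  ultimately show ?thesis
    unfolding solves_half_line_heat_problem_def using continuous_on_heat_boundary_potential by blast
qed

end

section \<open>The Sobolev bound by an integrable weight\<close>

definition power_weight :: "real \<Rightarrow> real \<Rightarrow> real" where
  "power_weight e x = (if x \<le> 1 then x powr e else x powr (- 2))"

lemma power_weight_integrable:
  assumes "e > - 1"
  shows "set_integrable lebesgue {0<..} (power_weight e)"
proof -
  have "(\<lambda>x. x powr e) absolutely_integrable_on {0..1}"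
    using has_integral_powr_from_0 [of e 1] assms
    by (intro nonnegative_absolutely_integrable_1) (auto simp: integrable_on_def)
  then have "(\<lambda>x. x powr e) absolutely_integrable_on {0<..1}"
    by (rule set_integrable_subset) auto
  then have 1: "power_weight e absolutely_integrable_on {0<..1}"
    by (rule set_integrable_cong [THEN iffD1, rotated -1]) (auto simp: power_weight_def)
  have "(\<lambda>x::real. x powr (- 2)) absolutely_integrable_on {1..}"
    using has_integral_powr_to_inf [of "- 2" 1]
    by (intro nonnegative_absolutely_integrable_1) (auto simp: integrable_on_def)
  then have "(\<lambda>x::real. x powr (- 2)) absolutely_integrable_on {1<..}"
    by (rule set_integrable_subset) auto
  then have 2: "power_weight e absolutely_integrable_on {1<..}"
    by (rule set_integrable_cong [THEN iffD1, rotated -1]) (auto simp: power_weight_def)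
  have "{0<..} = {0<..1} \<union> ({1<..} :: real set)"
    by auto
  then show ?thesis
    using set_integrable_Un [OF 1 2] by simp
qed

text \<open>The summands of \<open>K\<close> are the constants of the sup bound, the gradient bound
  near the boundary and the decay bound. Neither \<open>K\<close> nor \<open>W\<close> depends on
  \<open>\<psi>\<close>, \<open>S\<close> or \<open>H\<close>, which enter through \<open>N\<close>
  alone.\<close>

lemma (in holder_boundary_data) W1_heat_boundary_potential:
  fixes q N :: real
  defines "K \<equiv> 1 + (Gamma (1 / 2 - \<beta>) + 2 * Gamma (3 / 2 - \<beta>))
    + 4 * ((3 / 2) powr (3 / 2) + 2 * (5 / 2) powr (5 / 2)) * T"
    and "W \<equiv> LINT x:{0<..}|lebesgue. power_weight ((2 * \<beta> - 1) * q) x"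
  assumes q: "1 \<le> q" "q < 1 / (1 - 2 * \<beta>)" and N: "S \<le> N" "H \<le> N" and t: "t \<in> {0..T}"
  shows "heat_boundary_potential \<psi> t \<in> W1_space q {0<..}"
    and "W1_norm q {0<..} (heat_boundary_potential \<psi> t) \<le> (2 * W) powr (1 / q) * K * N"
proof -
  let ?u = "heat_boundary_potential \<psi> t" and ?v = "potential boundary_kernel_x t"
  define G where "G = Gamma (1 / 2 - \<beta>) + 2 * Gamma (3 / 2 - \<beta>)"
  define B where "B = 4 * ((3 / 2) powr (3 / 2) + 2 * (5 / 2) powr (5 / 2 :: real)) * T"
  have "Gamma (1 / 2 - \<beta>) > 0" "Gamma (3 / 2 - \<beta>) > 0"
    using \<beta> by (auto intro!: Gamma_real_pos)
  then have G: "G \<ge> 0"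
    by (simp add: G_def)
  have B: "B \<ge> 0"
    using T_pos by (simp add: B_def)
  have K: "K = 1 + G + B"
    by (simp add: K_def G_def B_def)
  have N0: "N \<ge> 0"
    using N S_nonneg by simp
  then have KN: "K * N \<ge> 0"
    using G B by (simp add: K)
  have GN: "H * G \<le> K * N" "S \<le> K * N" "S * B \<le> K * N"
  proof -
    have "H * G \<le> N * G" "S * B \<le> N * B"
      using N G B by (auto intro: mult_right_mono)
    moreover have "N * G \<ge> 0" "N * B \<ge> 0"
      using N0 G B by auto
    ultimately show "H * G \<le> K * N" "S \<le> K * N" "S * B \<le> K * N"
      using N N0 unfolding K by (simp_all add: algebra_simps)
  qed
  define w where "w = (\<lambda>x. (K * N) powr q * power_weight ((2 * \<beta> - 1) * q) x)"
  have le_w: "\<bar>y\<bar> powr q \<le> w x"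
    if x: "x > 0" and small: "x \<le> 1 \<Longrightarrow> \<bar>y\<bar> \<le> K * N * x powr (2 * \<beta> - 1)"
      and large: "x \<ge> 1 \<Longrightarrow> \<bar>y\<bar> \<le> K * N * x powr (- 2)" for x y
  proof (cases "x \<le> 1")
    case True
    then have "\<bar>y\<bar> powr q \<le> (K * N * x powr (2 * \<beta> - 1)) powr q"
      using small q by (intro powr_mono2) auto
    also have "\<dots> = w x"
      using True KN by (simp add: w_def power_weight_def powr_mult powr_powr)
    finally show ?thesis .
  next
    case False
    then have "\<bar>y\<bar> powr q \<le> (K * N * x powr (- 2)) powr q"
      using large q by (intro powr_mono2) auto
    also have "\<dots> = (K * N) powr q * x powr (- 2 * q)"
      using KN by (simp add: powr_mult powr_powr)
    \<comment> \<open>Since \<open>x > 1\<close> and \<open>q \<ge> 1\<close>, the decay only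
      improves under the power \<open>q\<close>.\<close>
    also have "\<dots> \<le> (K * N) powr q * x powr (- 2)"
      using False q by (intro mult_left_mono powr_mono) auto
    also have "\<dots> = w x"
      using False by (simp add: w_def power_weight_def)
    finally show ?thesis .
  qed
  have decay: "\<bar>potential boundary_kernel t x\<bar> \<le> K * N * x powr (- 2)"
    "\<bar>?v x\<bar> \<le> K * N * x powr (- 2)" if "x \<ge> 1" for x
  proof -
    have "S * B * x powr (- 2) \<le> K * N * x powr (- 2)"
      using GN(3) by (rule mult_right_mono) simp
    then show "\<bar>potential boundary_kernel t x\<bar> \<le> K * N * x powr (- 2)"
      "\<bar>?v x\<bar> \<le> K * N * x powr (- 2)"
      using potential_decay [OF t that] by (simp_all add: B_def mult_ac)
  qed
  have u: "\<bar>?u x\<bar> powr q \<le> w x" if x: "x > 0" for x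
  proof (rule le_w [OF x])
    assume "x \<le> 1"
    \<comment> \<open>The exponent is negative, so the singular weight is at least 1 here and
      absorbs the plain sup bound.\<close>
    then have "1 powr (2 * \<beta> - 1) \<le> x powr (2 * \<beta> - 1)"
      using x \<beta> by (intro powr_mono2') auto
    then have "K * N * 1 \<le> K * N * x powr (2 * \<beta> - 1)"
      using KN by (intro mult_left_mono) auto
    then show "\<bar>?u x\<bar> \<le> K * N * x powr (2 * \<beta> - 1)"
      using abs_potential_le [OF t x] GN(2) t x by (simp add: heat_boundary_potential_eq)
  qed (use decay t x in \<open>auto simp: heat_boundary_potential_eq\<close>)
  have v: "\<bar>?v x\<bar> powr q \<le> w x" if x: "x > 0" for x
  proof (rule le_w [OF x])
    have "H * G * x powr (2 * \<beta> - 1) \<le> K * N * x powr (2 * \<beta> - 1)"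
      using GN(1) by (rule mult_right_mono) simp
    then show "\<bar>?v x\<bar> \<le> K * N * x powr (2 * \<beta> - 1)"
      using potential_x_near_boundary [OF t x] by (simp add: G_def)
  qed (use decay in auto)
  \<comment> \<open>The upper bound on \<open>q\<close> says exactly that the singular weight is
    integrable at 0.\<close>
  have "(1 - 2 * \<beta>) * q < 1"
    using q \<beta> by (simp add: field_simps)
  then have w: "set_integrable lebesgue {0<..} w"
    unfolding w_def by (intro set_integrable_mult_right power_weight_integrable) (simp add: algebra_simps)
  have cv: "continuous_on {0<..} ?v"
    using DERIV_potential(2) by (meson DERIV_isCont continuous_at_imp_continuous_on greaterThan_iff)
  note W1 = W1_if_C1_dominated [OF DERIV_heat_boundary_potential(1) [OF t] cv w u v]
  show "?u \<in> W1_space q {0<..}"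
    by (rule W1) (use q in auto)
  have W: "W \<ge> 0"
    unfolding W_def set_lebesgue_integral_def
    by (rule Bochner_Integration.integral_nonneg) (auto simp: power_weight_def)
  have "W1_norm q {0<..} ?u \<le> (2 * (LINT x:{0<..}|lebesgue. w x)) powr (1 / q)"
    by (rule W1) (use q in auto)
  also have "(LINT x:{0<..}|lebesgue. w x) = (K * N) powr q * W"
    by (simp add: w_def W_def)
  also have "(2 * ((K * N) powr q * W)) powr (1 / q) = (2 * W) powr (1 / q) * K * N"
    using W abs_of_nonneg [OF KN] q by (simp add: powr_mult powr_powr abs_mult)
  finally show "W1_norm q {0<..} ?u \<le> (2 * W) powr (1 / q) * K * N" .
qed

theorem proposition15:
  fixes T \<beta> q :: real
  assumes "T > 0" and "0 < \<beta>" and "\<beta> < 1 / 2" and "1 \<le> q" and "q < 1 / (1 - 2 * \<beta>)"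
  shows "\<exists>C::real. \<forall>\<psi>\<in>holder_space \<beta> {0..T}. \<psi> 0 = 0 \<longrightarrow>
    (let u = heat_boundary_potential \<psi> in
       solves_half_line_heat_problem T \<psi> u \<and>
       (\<forall>t\<in>{0..T}. u t \<in> W1_space q {0<..}) \<and>
       bdd_above ((\<lambda>t. W1_norm q {0<..} (u t)) ` {0..T}) \<and>
       (SUP t\<in>{0..T}. W1_norm q {0<..} (u t)) \<le> C * holder_norm \<beta> {0..T} \<psi>)"
proof -
  \<comment> \<open>\<open>C\<close> is fixed before \<open>\<psi>\<close>, \<open>S\<close> and
    \<open>H\<close>: the factor \<open>(2 * W) powr (1 / q) * K\<close> depends only on
    \<open>T\<close>, \<open>\<beta>\<close> and \<open>q\<close>.\<close>
  obtain C where C: "\<And>S H \<psi> t N. holder_boundary_data T \<beta> S H \<psi> \<Longrightarrow> S \<le> N \<Longrightarrow> H \<le> N \<Longrightarrow> t \<in> {0..T} \<Longrightarrow>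
      heat_boundary_potential \<psi> t \<in> W1_space q {0<..} \<and>
      W1_norm q {0<..} (heat_boundary_potential \<psi> t) \<le> C * N"
    using holder_boundary_data.W1_heat_boundary_potential assms(4,5) by meson
  show ?thesis
  proof (intro exI [of _ C] ballI impI)
    fix \<psi> assume \<psi>: "\<psi> \<in> holder_space \<beta> {0..T}" and \<psi>0: "\<psi> 0 = 0"
    define S where "S = (SUP t\<in>{0..T}. \<bar>\<psi> t\<bar>)"
    define H where "H = Sup (holder_quotients \<beta> {0..T} \<psi>)"
    have S: "\<bar>\<psi> t\<bar> \<le> S" if "t \<in> {0..T}" for t
      unfolding S_def using \<psi> that by (intro cSUP_upper) (auto simp: holder_space_def)
    have quot: "\<bar>\<psi> s - \<psi> t\<bar> / \<bar>s - t\<bar> powr \<beta> \<le> H" if "s \<in> {0..T}" "t \<in> {0..T}" "s \<noteq> t" for s t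
      unfolding H_def using \<psi> that
      by (intro cSup_upper) (auto simp: holder_space_def holder_quotients_def)
    have H: "\<bar>\<psi> s - \<psi> t\<bar> \<le> H * \<bar>s - t\<bar> powr \<beta>" if "s \<in> {0..T}" "t \<in> {0..T}" for s t
      using quot [OF that] by (cases "s = t") (auto simp: field_simps)
    interpret holder_boundary_data T \<beta> S H \<psi>
      by unfold_locales (use assms S H \<psi>0 in auto)
    have N: "holder_norm \<beta> {0..T} \<psi> = S + H"
      by (simp add: holder_norm_def S_def H_def)
    \<comment> \<open>Being nonnegative, \<open>S\<close> and \<open>H\<close> are both at most
      \<open>N = S + H\<close>, which is the Hoelder norm.\<close>
    have W1: "heat_boundary_potential \<psi> t \<in> W1_space q {0<..}"
      "W1_norm q {0<..} (heat_boundary_potential \<psi> t) \<le> C * holder_norm \<beta> {0..T} \<psi>"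
      if "t \<in> {0..T}" for t
      using C [OF holder_boundary_data_axioms _ _ that, of "S + H"] S_nonneg H_nonneg N by auto
    have "(SUP t\<in>{0..T}. W1_norm q {0<..} (heat_boundary_potential \<psi> t)) \<le> C * holder_norm \<beta> {0..T} \<psi>"
      using assms(1) W1(2) by (intro cSUP_least) auto
    moreover have "bdd_above ((\<lambda>t. W1_norm q {0<..} (heat_boundary_potential \<psi> t)) ` {0..T})"
      using W1(2) by (intro bdd_aboveI2)
    ultimately show "let u = heat_boundary_potential \<psi> in
       solves_half_line_heat_problem T \<psi> u \<and>
       (\<forall>t\<in>{0..T}. u t \<in> W1_space q {0<..}) \<and>
       bdd_above ((\<lambda>t. W1_norm q {0<..} (u t)) ` {0..T}) \<and>
       (SUP t\<in>{0..T}. W1_norm q {0<..} (u t)) \<le> C * holder_norm \<beta> {0..T} \<psi>"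
      using solves_half_line_heat_problem W1(1) by (simp add: Let_def)
  qed
qed

end
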